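(* Let $u$ be a solution of the superconductivity problem $\Delta u=\chi_{\{|\nabla u|>0\}}$ in $B_1\subset\mathbb{R}^n$ (in the sense described in the context), and suppose $0\in\Sigma$ and $$u\le u(0)\quad\text{on }\{x\in B_1: |\nabla u(x)|=0\}.$$ Then there exists $q_0\in\mathcal{Q}$ such that $$u_r(x):=\frac{u(rx)-u(0)}{r^2}\longrightarrow q_0\quad\text{in } C^{1,\alpha}_{\rm loc}(\mathbb{R}^n)\ \text{ as } r\to0^+$$ for every $\alpha\in(0,1)$ (i.e. the full family converges, not merely along a subsequence). Moreover, $$u(x)-u(0)=q_0(x)+o(|x|^2)\quad\text{as } x\to0 .$$
   Context: $B_1$ is the open unit ball of $\mathbb{R}^n$. A solution of $\Delta u=\chi_{\{|\nabla u|>0\}}$ in $B_1$ means a function $u\in C^{1,1}_{\rm loc}(B_1)$ with $\|D^2u\|_{L^\infty(B_1)}\le M$ for some constant $M>0$, satisfying $\Delta u=\chi_{\{|\nabla u|>0\}}$ a.e. in $B_1$, and with $0\in\Gamma:=\partial\{|\nabla u|>0\}\cap B_1$ (the free boundary). $\mathcal{Q}$ denotes the set of homogeneous quadratic polynomials $q$ on $\mathbb{R}^n$ with $\Delta q=1$, i.e. $q(x)=\tfrac12 x\cdot Ax$ with $A$ symmetric and $\operatorname{Tr}A=1$. The singular set $\Sigma\subset\Gamma$ is defined by: $x^0\in\Sigma$ iff there exists a sequence $r_j\to0$ such that $u_{x^0,r_j}(x):=\frac{u(x^0+r_jx)-u(x^0)}{r_j^2}$ converges (in $C^{1,\alpha}_{\rm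 loc}(\mathbb{R}^n)$) to some $q\in\mathcal{Q}$. *)

theory Defs
  imports "HOL-Analysis.Analysis"
begin

text \<open>Gradient of a real function on R^n (meaningful where u is differentiable).\<close>
definition grad :: "(real^'n \<Rightarrow> real) \<Rightarrow> real^'n \<Rightarrow> real^'n" where
  "grad u x = (\<chi> i. frechet_derivative u (at x) (axis i 1))"

definition laplacian :: "(real^'n \<Rightarrow> real) \<Rightarrow> real^'n \<Rightarrow> real" where
  "laplacian u x = trace (jacobian (grad u) (at x))"

definition free_boundary :: "(real^'n \<Rightarrow> real) \<Rightarrow> (real^'n) set" where
  "free_boundary u = frontier {x \<in> ball 0 1. grad u x \<noteq> 0} \<inter> ball 0 1"

definition supercond_solution :: "(real^'n \<Rightarrow> real) \<Rightarrow> real \<Rightarrow> bool" where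
  "supercond_solution u M \<longleftrightarrow> M > 0
     \<and> (\<forall>x\<in>ball 0 1. u differentiable (at x))
     \<and> (\<forall>x\<in>ball 0 1. \<forall>y\<in>ball 0 1. norm (grad u x - grad u y) \<le> M * norm (x - y))
     \<and> (AE x in lebesgue. x \<in> ball 0 1 \<longrightarrow>
          grad u differentiable (at x) \<and>
          laplacian u x = (if grad u x \<noteq> 0 then 1 else 0))
     \<and> 0 \<in> free_boundary u"

definition quad_Q :: "(real^'n \<Rightarrow> real) set" where
  "quad_Q = {q. \<exists>A::real^'n^'n. transpose A = A \<and> trace A = 1 \<and>
                   q = (\<lambda>x. (1/2) * (x \<bullet> (A *v x)))}"

definition conv_C1alpha_loc ::
  "'b filter \<Rightarrow> real \<Rightarrow> ('b \<Rightarrow> real^'n \<Rightarrow> real) \<Rightarrow> (real^'n \<Rightarrow> real) \<Rightarrow> bool" where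
  "conv_C1alpha_loc F \<alpha> f g \<longleftrightarrow>
     (\<forall>R>0. \<forall>\<epsilon>>0. eventually (\<lambda>t.
        (\<forall>x\<in>cball 0 R. f t differentiable (at x)) \<and>
        (\<forall>x\<in>cball 0 R. \<bar>f t x - g x\<bar> \<le> \<epsilon> \<and> norm (grad (f t) x - grad g x) \<le> \<epsilon>) \<and>
        (\<forall>x\<in>cball 0 R. \<forall>y\<in>cball 0 R. x \<noteq> y \<longrightarrow>
            norm ((grad (f t) x - grad g x) - (grad (f t) y - grad g y))
              \<le> \<epsilon> * norm (x - y) powr \<alpha>)) F)"

definition rescale :: "(real^'n \<Rightarrow> real) \<Rightarrow> real^'n \<Rightarrow> real \<Rightarrow> real^'n \<Rightarrow> real" where
  "rescale u x0 r x = (u (x0 + r *\<^sub>R x) - u x0) / r\<^sup>2"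

definition singular_set :: "(real^'n \<Rightarrow> real) \<Rightarrow> (real^'n) set" where
  "singular_set u = {x0 \<in> free_boundary u. \<exists>r::nat \<Rightarrow> real. (\<forall>j. r j > 0) \<and> r \<longlonglongrightarrow> 0 \<and>
      (\<exists>q\<in>quad_Q. \<forall>\<alpha>\<in>{0<..<1}. conv_C1alpha_loc sequentially \<alpha> (\<lambda>j. rescale u x0 (r j)) q)}"

end

theory Submission
  imports Defs
begin

text \<open>
  Write \<open>w = u - u 0 - p\<close> for a quadratic \<open>p\<close> with Laplacian one, so that the Laplacian of \<open>w\<close> is minus the
  indicator of the flat set where the gradient of \<open>u\<close> vanishes. There \<open>u \<le> u 0\<close>, which makes the Weiss
  functional of \<open>w\<close> non-decreasing in the radius; along the blow-up sequence provided by the singular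
  point it tends to zero, hence it is non-negative. The derivative of Monneau's functional, a scaled
  weighted integral of \<open>w\<^sup>2\<close>, is the Weiss functional plus an integral of \<open>p - (u - u 0)\<close> over the flat
  set, so it is non-decreasing whenever \<open>p \<ge> 0\<close>. The blow-up limit \<open>q\<close> need not be non-negative, but
  the Monneau functional of \<open>q\<close> plus a large multiple of the one of \<open>(norm x)\<^sup>2 / (2 * n)\<close> is still
  non-decreasing, so the functional of \<open>q\<close> has a limit as the radius tends to zero. This limit is zero
  along the blow-up sequence, hence zero, and the uniform Lipschitz bound on the gradient upgrades
  this to the claimed convergence.

  All surface integrals are avoided by the weights \<open>max 0 (r\<^sup>2 - (norm x)\<^sup>2) ^ k\<close>.
\<close>

section \<open>Integration by parts against a compactly supported weight\<close>

text \<open>The derivative of the Weiss functional is a square plus a term in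
  \<open>euler x * lap x\<close>, with \<open>euler x = x \<bullet> G x - 2 * w x\<close>.
  Homogeneous quadratics drop out of \<open>euler\<close>, so on the flat set it equals
  \<open>-2 * (u x - u 0)\<close> whatever the sign of \<open>p\<close>; this is where the one-sided
  hypothesis enters. Non-negativity of the Weiss functional is wanted for two quadratics, although
  the blow-up sequence converges to only one: along it the functional tends to that of a difference
  \<open>q - p\<close>, which is harmonic and homogeneous of degree two and therefore has Weiss
  functional zero. The sign of \<open>p\<close> matters only for Monneau. That functional is
  quadratic in \<open>w\<close>, but the critical term of its derivative is the integral of
  \<open>w * lap\<close>, and \<open>lap\<close> is the same function for all quadratics with
  Laplacian one. So derivatives for different quadratics add up to a term that sees only the
  combined quadratic, and a large multiple of the positive one outweighs the negative part of
  \<open>q\<close>. The positive one has a monotone functional of its own, which is why the limit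
  for \<open>q\<close> can be recovered by subtraction.\<close>

lemma continuous_compact_support_integrable:
  fixes f :: "'a::euclidean_space \<Rightarrow> real"
  assumes "continuous_on UNIV f" and supp: "\<And>x. norm x > R \<Longrightarrow> f x = 0"
  shows "f integrable_on UNIV"
proof -
  obtain a where a: "cball 0 R \<subseteq> cbox (-a) (a::'a)"
    using bounded_subset_cbox_symmetric[of "cball 0 R"] bounded_cball by blast
  have "f integrable_on cbox (-a) a"
    by (intro integrable_continuous continuous_on_subset[OF assms(1)]) auto
  then show ?thesis
    using integrable_on_superset[of f "cbox (-a) a" UNIV] supp a by (meson linorder_not_less mem_cball_0 subset_UNIV subsetD)
qed

lemma has_integral_translate_compact_support:
  fixes f :: "'a::euclidean_space \<Rightarrow> real"
  assumes "continuous_on UNIV f" and supp: "\<And>x. norm x > R \<Longrightarrow> f x = 0"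
  shows "((\<lambda>x. f (x + c)) has_integral integral UNIV f) UNIV"
proof -
  obtain a where a: "cball 0 R \<subseteq> cbox (-a) (a::'a)"
    using bounded_subset_cbox_symmetric[of "cball 0 R"] bounded_cball by blast
  have out: "f x = 0" if "x \<notin> cbox (-a) a" for x
    using that supp a by (meson linorder_not_less mem_cball_0 subsetD)
  have "f integrable_on cbox (-a) a"
    by (intro integrable_continuous continuous_on_subset[OF assms(1)]) auto
  then obtain I where I: "(f has_integral I) (cbox (-a) a)" by blast
  then have "(f has_integral I) UNIV"
    by (rule has_integral_on_superset) (use out in auto)
  then have I_eq: "integral UNIV f = I" by blast
  have "((\<lambda>x. f (x + c)) has_integral I) (cbox (-a - c) (a - c))"
    using I has_integral_shift_cbox_iff[of f c I "-a - c" "a - c"] by (simp add: o_def add.commute)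
  then have "((\<lambda>x. f (x + c)) has_integral I) UNIV"
  proof (rule has_integral_on_superset)
    fix x assume "x \<notin> cbox (-a - c) (a - c)"
    then have "x + c \<notin> cbox (-a) a"
      by (auto simp: mem_box algebra_simps)
    then show "f (x + c) = 0" by (rule out)
  qed auto
  then show ?thesis using I_eq by simp
qed

text \<open>The difference quotients of \<open>f\<close> integrate to zero by translation invariance; the Lipschitz
  bound makes dominated convergence applicable.\<close>

lemma has_integral_directional_derivative_zero:
  fixes f :: "'a::euclidean_space \<Rightarrow> real"
  assumes lip: "\<And>x y. \<bar>f x - f y\<bar> \<le> L * norm (x - y)"
    and supp: "\<And>x. norm x > R \<Longrightarrow> f x = 0"
    and N: "negligible N"
    and der: "\<And>x. x \<notin> N \<Longrightarrow> (f has_derivative f' x) (at x)"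
  shows "((\<lambda>x. f' x e) has_integral 0) UNIV"
proof -
  have "L \<ge> 0"
  proof -
    obtain b :: 'a where "b \<in> Basis" by (meson nonempty_Basis all_not_in_conv)
    then show ?thesis using lip[of b 0] by simp
  qed
  then have "(\<bar>L\<bar>)-lipschitz_on UNIV f"
    using lip by (auto simp: lipschitz_on_def dist_norm)
  then have cont: "continuous_on UNIV f" by (rule lipschitz_on_continuous_on)
  define s where "s k x = real (Suc k) * (f (x + e /\<^sub>R real (Suc k)) - f x)" for k x
  have s_int: "(s k has_integral 0) UNIV" for k
  proof -
    have "((\<lambda>x. f (x + e /\<^sub>R real (Suc k)) - f x) has_integral integral UNIV f - integral UNIV f) UNIV"
      by (intro has_integral_diff has_integral_translate_compact_support[OF cont, of R] supp
          integrable_integral continuous_compact_support_integrable[OF cont, of R])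
    from has_integral_mult_right[OF this, of "real (Suc k)"]
    show ?thesis by (simp add: s_def[abs_def])
  qed
  \<comment> \<open>The dominating function: a translation by at most \<open>norm e\<close> enlarges
    the support by that much, and the Lipschitz bound on the quotient does not depend on the step
    length.\<close>
  define h where "h x = (if x \<in> cball 0 (R + norm e) then L * norm e else 0)" for x :: 'a
  have h_int: "h integrable_on UNIV"
    unfolding h_def integrable_restrict_UNIV
    by (rule integrable_on_const) simp
  have s_bound: "norm (s k x) \<le> h x" for k x
  proof (cases "x \<in> cball 0 (R + norm e)")
    case True
    have "\<bar>f (x + e /\<^sub>R real (Suc k)) - f x\<bar> \<le> L * (norm e / real (Suc k))"
      using lip[of "x + e /\<^sub>R real (Suc k)" x] by (simp add: field_simps)
    then have "real (Suc k) * \<bar>f (x + e /\<^sub>R real (Suc k)) - f x\<bar> \<le> L * norm e"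
      by (simp add: field_simps)
    then show ?thesis using True by (simp add: s_def h_def abs_mult)
  next
    case False
    have "norm (e /\<^sub>R real (Suc k)) \<le> norm e"
      using mult_left_mono[of 1 "real (Suc k)" "norm e"] by (simp add: divide_simps)
    moreover have "norm x > R + norm e" using False by simp
    moreover have "norm x \<le> norm (x + e /\<^sub>R real (Suc k)) + norm (e /\<^sub>R real (Suc k))"
      by (metis add_diff_cancel_right' norm_triangle_ineq4)
    ultimately have "norm (x + e /\<^sub>R real (Suc k)) > R" "norm x > R"
      using norm_ge_zero[of e] by linarith+
    then have "s k x = 0" by (simp only: s_def supp) simp
    then show ?thesis using False by (simp add: h_def)
  qed
  have s_lim: "(\<lambda>k. s k x) \<longlonglongrightarrow> f' x e" if "x \<in> - N" for x
  proof -
    have "((\<lambda>t. f (x + t *\<^sub>R e)) has_vector_derivative f' x e) (at 0)"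
    proof -
      have d: "(f has_derivative f' x) (at (x + 0 *\<^sub>R e))" using der that by simp
      have "((\<lambda>t. f (x + t *\<^sub>R e)) has_derivative (\<lambda>t. f' x (t *\<^sub>R e))) (at 0)"
        by (rule has_derivative_compose[of "\<lambda>t. x + t *\<^sub>R e" "\<lambda>t. t *\<^sub>R e" 0 UNIV f "f' x", OF _ d]) (auto intro!: derivative_eq_intros)
      moreover have "f' x (t *\<^sub>R e) = t *\<^sub>R f' x e" for t
        using der[of x] that by (simp add: has_derivative_bounded_linear linear_simps)
      ultimately show ?thesis by (simp add: has_vector_derivative_def)
    qed
    then have "((\<lambda>t. (f (x + t *\<^sub>R e) - f x) / t) \<longlongrightarrow> f' x e) (at 0)"
      by (simp add: has_real_derivative_iff_has_vector_derivative[symmetric] DERIV_def)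
    moreover have "filterlim (\<lambda>k. inverse (real (Suc k))) (at 0) sequentially"
      unfolding filterlim_at using LIMSEQ_inverse_real_of_nat by simp
    ultimately have "(\<lambda>k. (f (x + inverse (real (Suc k)) *\<^sub>R e) - f x) / inverse (real (Suc k))) \<longlonglongrightarrow> f' x e"
      by (rule filterlim_compose)
    then show ?thesis by (simp add: s_def divide_inverse mult.commute)
  qed
  have s_int': "(s k has_integral 0) (-N)" for k
    using has_integral_spike_set_eq[of UNIV "-N" "s k" 0] s_int[of k] negligible_subset[OF N] by auto
  have h_int': "h integrable_on - N"
    using integrable_spike_set[OF h_int, of "-N"] negligible_subset[OF N] by auto
  have g: "(\<lambda>x. f' x e) integrable_on -N" "(\<lambda>k. integral (-N) (s k)) \<longlonglongrightarrow> integral (-N) (\<lambda>x. f' x e)"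
    by (rule dominated_convergence[where f = s and h = h];
        use s_int' h_int' s_bound s_lim in \<open>auto simp: has_integral_integrable\<close>)+
  have "integral (-N) (s k) = 0" for k using s_int'[of k] by blast
  then have "integral (-N) (\<lambda>x. f' x e) = 0"
    using g(2) LIMSEQ_unique[OF _ tendsto_const[of 0]] by auto
  then have "((\<lambda>x. f' x e) has_integral 0) (-N)" using g(1) by (metis integrable_integral)
  then show ?thesis
    using has_integral_spike_set_eq[of UNIV "-N" "\<lambda>x. f' x e" 0] negligible_subset[OF N] by auto
qed

section \<open>Bounded Lipschitz functions\<close>

text \<open>Boundedness is built in because Lipschitz functions alone are not closed under products,
  while the integrands below are products such as \<open>w x * w x\<close> and
  \<open>euler x *\<^sub>R G x\<close>. One constant serves both bounds.\<close>

definition blip_on :: "'a::real_normed_vector set \<Rightarrow> ('a \<Rightarrow> 'b::real_normed_vector) \<Rightarrow> bool" where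
  "blip_on S f \<longleftrightarrow> (\<exists>B. (\<forall>x\<in>S. norm (f x) \<le> B) \<and> (\<forall>x\<in>S. \<forall>y\<in>S. norm (f x - f y) \<le> B * norm (x - y)))"

lemma blip_onI:
  assumes "\<And>x. x \<in> S \<Longrightarrow> norm (f x) \<le> B" "\<And>x y. x \<in> S \<Longrightarrow> y \<in> S \<Longrightarrow> norm (f x - f y) \<le> C * norm (x - y)"
  shows "blip_on S f"
  unfolding blip_on_def
proof (intro exI conjI ballI)
  fix x y assume "x \<in> S" "y \<in> S"
  show "norm (f x) \<le> max B C" using assms(1)[OF \<open>x \<in> S\<close>] by simp
  show "norm (f x - f y) \<le> max B C * norm (x - y)"
    using assms(2)[OF \<open>x \<in> S\<close> \<open>y \<in> S\<close>] mult_right_mono[of C "max B C" "norm (x - y)"] by simp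
qed

lemma blip_onE:
  assumes "blip_on S f"
  obtains B where "B \<ge> 0" "\<forall>x\<in>S. norm (f x) \<le> B"
    "\<forall>x\<in>S. \<forall>y\<in>S. norm (f x - f y) \<le> B * norm (x - y)"
proof -
  obtain B where B: "\<forall>x\<in>S. norm (f x) \<le> B" "\<forall>x\<in>S. \<forall>y\<in>S. norm (f x - f y) \<le> B * norm (x - y)"
    using assms unfolding blip_on_def by blast
  have "norm (f x - f y) \<le> \<bar>B\<bar> * norm (x - y)" if "x \<in> S" "y \<in> S" for x y
    using B(2) that mult_right_mono[of B "\<bar>B\<bar>" "norm (x - y)"] by force
  with B(1) show thesis using that[of "\<bar>B\<bar>"] by force
qed

text \<open>Proved once for an arbitrary bounded bilinear product, so that multiplication, inner
  product and scaling are all instances.\<close>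

lemma (in bounded_bilinear) blip_on:
  assumes "blip_on S f" "blip_on S g"
  shows "blip_on S (\<lambda>x. prod (f x) (g x))"
proof -
  obtain B where B: "B \<ge> 0" "\<forall>x\<in>S. norm (f x) \<le> B"
    "\<forall>x\<in>S. \<forall>y\<in>S. norm (f x - f y) \<le> B * norm (x - y)"
    by (rule blip_onE[OF assms(1)])
  obtain C where C: "C \<ge> 0" "\<forall>x\<in>S. norm (g x) \<le> C"
    "\<forall>x\<in>S. \<forall>y\<in>S. norm (g x - g y) \<le> C * norm (x - y)"
    by (rule blip_onE[OF assms(2)])
  obtain K where K: "K > 0" "\<And>a b. norm (prod a b) \<le> norm a * norm b * K"
    using pos_bounded by blast
  show ?thesis
  proof (rule blip_onI)
    fix x assume "x \<in> S"
    then show "norm (prod (f x) (g x)) \<le> B * C * K"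
      using B(1,2) C(1,2) K(1)
      by (intro order_trans[OF K(2)[of "f x" "g x"]] mult_mono mult_right_mono mult_nonneg_nonneg) auto
  next
    fix x y assume xy: "x \<in> S" "y \<in> S"
    have "prod (f x) (g x) - prod (f y) (g y) = prod (f x - f y) (g x) + prod (f y) (g x - g y)"
      by (simp add: diff_left diff_right)
    then have "norm (prod (f x) (g x) - prod (f y) (g y))
        \<le> norm (f x - f y) * norm (g x) * K + norm (f y) * norm (g x - g y) * K"
      using norm_triangle_ineq[of "prod (f x - f y) (g x)" "prod (f y) (g x - g y)"]
        K(2)[of "f x - f y" "g x"] K(2)[of "f y" "g x - g y"] by simp
    also have "\<dots> \<le> (B * norm (x - y)) * C * K + B * (C * norm (x - y)) * K"
      using B C K(1) xy by (intro add_mono mult_mono mult_right_mono mult_nonneg_nonneg) auto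
    finally show "norm (prod (f x) (g x) - prod (f y) (g y)) \<le> 2 * B * C * K * norm (x - y)"
      by (simp add: algebra_simps)
  qed
qed

lemmas blip_on_mult = bounded_bilinear.blip_on[OF bounded_bilinear_mult]
  and blip_on_inner = bounded_bilinear.blip_on[OF bounded_bilinear_inner]
  and blip_on_scaleR = bounded_bilinear.blip_on[OF bounded_bilinear_scaleR]

lemma blip_on_const: "blip_on S (\<lambda>x. c)"
  by (rule blip_onI[where B = "norm c" and C = 0]) auto

lemma blip_on_id: "bounded S \<Longrightarrow> blip_on S (\<lambda>x. x)"
  unfolding bounded_iff blip_on_def
  by (elim exE, rule_tac x = "max a 1" in exI) (use mult_right_mono[of 1 "max _ 1"] in fastforce)

lemma blip_on_diff:
  assumes "blip_on S f" "blip_on S g"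
  shows "blip_on S (\<lambda>x. f x - g x)"
proof -
  obtain B where B: "B \<ge> 0" "\<forall>x\<in>S. norm (f x) \<le> B"
    "\<forall>x\<in>S. \<forall>y\<in>S. norm (f x - f y) \<le> B * norm (x - y)"
    by (rule blip_onE[OF assms(1)])
  obtain C where C: "C \<ge> 0" "\<forall>x\<in>S. norm (g x) \<le> C"
    "\<forall>x\<in>S. \<forall>y\<in>S. norm (g x - g y) \<le> C * norm (x - y)"
    by (rule blip_onE[OF assms(2)])
  show ?thesis
  proof (rule blip_onI)
    fix x assume "x \<in> S"
    then show "norm (f x - g x) \<le> B + C" using B(2) C(2) norm_triangle_ineq4[of "f x" "g x"] by fastforce
  next
    fix x y assume xy: "x \<in> S" "y \<in> S"
    have "norm ((f x - g x) - (f y - g y)) \<le> norm (f x - f y) + norm (g x - g y)"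
      using norm_triangle_ineq4[of "f x - f y" "g x - g y"] by (simp add: algebra_simps)
    also have "\<dots> \<le> (B + C) * norm (x - y)" using add_mono[OF B(3)[rule_format, OF xy] C(3)[rule_format, OF xy]] by (simp add: algebra_simps)
    finally show "norm ((f x - g x) - (f y - g y)) \<le> (B + C) * norm (x - y)" .
  qed
qed

lemma blip_on_continuous: "blip_on S f \<Longrightarrow> continuous_on S f"
  by (metis blip_onE dist_norm lipschitz_onI lipschitz_on_continuous_on)

section \<open>Weights supported in a ball\<close>

text \<open>The gradient of \<open>bump r x ^ k\<close> is
  \<open>- 2 * k * bump r x ^ (k - 1)\<close> times \<open>x\<close>, and its derivative in
  \<open>r\<close> is \<open>2 * k * r * bump r x ^ (k - 1)\<close>. Both lower the exponent by one,
  so the usual boundary terms become solid integrals with the next lower weight.\<close>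

definition bump :: "real \<Rightarrow> 'a::real_normed_vector \<Rightarrow> real" where
  "bump r x = max 0 (r\<^sup>2 - (norm x)\<^sup>2)"

lemma bump_nonneg [simp]: "bump r x \<ge> 0" by (simp add: bump_def)

lemma bump_le: "bump r x \<le> r\<^sup>2" by (simp add: bump_def)

lemma bump_outside: "r \<ge> 0 \<Longrightarrow> norm x \<ge> r \<Longrightarrow> bump r x = 0"
  by (simp add: bump_def power_mono)

lemma bump_inside: "norm x \<le> r \<Longrightarrow> bump r x = r\<^sup>2 - (norm x)\<^sup>2"
  by (simp add: bump_def power_mono)

lemma blip_on_bump_power:
  assumes "r \<ge> 0" shows "blip_on S (\<lambda>x. bump r x ^ k)"
proof (induction k)
  case (Suc k)
  have "blip_on S (bump r)"
  proof (rule blip_onI)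
    fix x :: 'a show "norm (bump r x) \<le> r\<^sup>2" using bump_le[of r x] by simp
  next
    fix x y :: 'a
    \<comment> \<open>Truncating the norm at \<open>r\<close> makes the weight a difference of
      squares of numbers in \<open>[0, r]\<close>, whence the Lipschitz constant
      \<open>2 * r\<close>.\<close>
    have eq: "bump r z = r\<^sup>2 - (min r (norm z))\<^sup>2" for z :: 'a
      using bump_outside[OF assms, of z] bump_inside[of z r] by (auto simp: min_def)
    have "norm (bump r x - bump r y) = \<bar>min r (norm y) - min r (norm x)\<bar> * (min r (norm y) + min r (norm x))"
    proof -
      have "bump r x - bump r y = (min r (norm y) - min r (norm x)) * (min r (norm y) + min r (norm x))"
        by (simp add: eq algebra_simps power2_eq_square)
      moreover have "min r (norm y) + min r (norm x) \<ge> 0" using assms by simp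
      ultimately show ?thesis by (simp add: abs_mult)
    qed
    also have "\<dots> \<le> norm (x - y) * (r + r)"
      by (intro mult_mono add_mono) (use assms norm_triangle_ineq3[of x y] in auto)
    finally show "norm (bump r x - bump r y) \<le> 2 * r * norm (x - y)" by (simp add: algebra_simps)
  qed
  then show ?case using blip_on_mult[OF _ Suc] by simp
qed (simp add: blip_on_const)

text \<open>Nothing is known about \<open>f\<close> outside the unit ball, but the weight vanishes
  there. The product is therefore Lipschitz on the whole space, as the translation argument
  requires.\<close>

lemma blip_on_bump_mult:
  assumes f: "blip_on (ball 0 1) (f :: 'a::real_normed_vector \<Rightarrow> real)" and r: "0 \<le> r" "r \<le> 1" and "k \<ge> 1"
  shows "blip_on UNIV (\<lambda>x. bump r x ^ k * f x)"
proof -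
  obtain B where B: "B \<ge> 0" "\<And>x. x \<in> ball 0 1 \<Longrightarrow> norm (f x) \<le> B"
    using blip_onE[OF f] by (metis (no_types, lifting))
  obtain C where C: "C \<ge> 0" "\<And>x::'a. bump r x ^ k \<le> C"
     "\<And>x y::'a. \<bar>bump r x ^ k - bump r y ^ k\<bar> \<le> C * norm (x - y)"
    using blip_onE[OF blip_on_bump_power[OF r(1), of UNIV k]]
    by (metis UNIV_I bump_nonneg real_norm_def abs_of_nonneg zero_le_power)
  obtain D where D: "D \<ge> 0"
    "\<And>x y. x \<in> ball 0 1 \<Longrightarrow> y \<in> ball 0 1 \<Longrightarrow> \<bar>bump r x ^ k * f x - bump r y ^ k * f y\<bar> \<le> D * norm (x - y)"
    using blip_onE[OF blip_on_mult[OF blip_on_bump_power[OF r(1)] f, of k]]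
    by (metis real_norm_def)
  have out: "bump r x ^ k = 0" if "x \<notin> ball 0 1" for x :: 'a
    using that r \<open>k \<ge> 1\<close> bump_outside[of r x] by simp
  show ?thesis
  proof (rule blip_onI)
    fix x :: 'a
    show "norm (bump r x ^ k * f x) \<le> C * B"
    proof (cases "x \<in> ball 0 1")
      case True
      then show ?thesis using B C by (auto simp: abs_mult intro!: mult_mono)
    next
      case False
      then show ?thesis using B(1) C(1) out[OF False] by (simp del: power_eq_0_iff)
    qed
  next
    fix x y :: 'a
    \<comment> \<open>With \<open>y\<close> outside the unit ball the second product is zero, so the
      increment of the weight alone carries the estimate and no comparison of \<open>f x\<close>
      with \<open>f y\<close> is made.\<close>
    have mixed: "\<bar>bump r x ^ k * f x - bump r y ^ k * f y\<bar> \<le> (C * B) * norm (x - y)"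
      if "x \<in> ball 0 1" "y \<notin> ball 0 1" for x y :: 'a
    proof -
      have "\<bar>bump r x ^ k * f x - bump r y ^ k * f y\<bar> = \<bar>bump r x ^ k - bump r y ^ k\<bar> * \<bar>f x\<bar>"
        using out[OF that(2)] by (simp add: abs_mult del: power_eq_0_iff)
      also have "\<dots> \<le> (C * norm (x - y)) * B"
        by (intro mult_mono C) (use B C that in auto)
      finally show ?thesis by (simp add: algebra_simps)
    qed
    have "\<bar>bump r x ^ k * f x - bump r y ^ k * f y\<bar> \<le> D * norm (x - y) \<or>
          \<bar>bump r x ^ k * f x - bump r y ^ k * f y\<bar> \<le> (C * B) * norm (x - y)"
      using D(2)[of x y] mixed[of x y] mixed[of y x] out[of x] out[of y] B(1) C(1)
        abs_minus_commute[of "bump r x ^ k * f x"] norm_minus_commute[of x y]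
      by (cases "x \<in> ball 0 1"; cases "y \<in> ball 0 1") (simp_all del: power_eq_0_iff mem_ball)
    moreover have "D * norm (x - y) \<ge> 0" "(C * B) * norm (x - y) \<ge> 0" using B C D by auto
    ultimately show "norm (bump r x ^ k * f x - bump r y ^ k * f y) \<le> (C * B + D) * norm (x - y)"
      by (auto simp: algebra_simps)
  qed
qed

lemma has_real_derivative_max_power:
  fixes t :: real
  assumes "k \<ge> 2"
  shows "((\<lambda>t. (max 0 t) ^ k) has_real_derivative real k * (max 0 t) ^ (k - 1)) (at t)"
proof -
  consider "t > 0" | "t < 0" | "t = 0" by linarith
  then show ?thesis
  proof cases
    case 1
    have "((\<lambda>t. t ^ k) has_real_derivative real k * (max 0 t) ^ (k - 1)) (at t)"
      using 1 by (auto intro!: derivative_eq_intros)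
    then show ?thesis
      by (rule DERIV_cong_ev[THEN iffD1, OF refl _ refl, rotated])
         (use 1 eventually_nhds_in_open[of "{0<..}" t] in \<open>auto elim!: eventually_mono\<close>)
  next
    case 2
    have "((\<lambda>t. 0) has_real_derivative real k * (max 0 t) ^ (k - 1)) (at t)"
      using 2 assms by (auto intro!: derivative_eq_intros)
    then show ?thesis
      by (rule DERIV_cong_ev[THEN iffD1, OF refl _ refl, rotated])
         (use 2 assms eventually_nhds_in_open[of "{..<0}" t] in \<open>auto elim!: eventually_mono\<close>)
  next
    case 3
    \<comment> \<open>At the edge of the support the quotient is at most
      \<open>\<bar>h\<bar> ^ (k - 1)\<close>, which tends to zero because \<open>k \<ge> 2\<close>;
      for \<open>k = 1\<close> there would be a kink.\<close>
    have "((\<lambda>h::real. (max 0 h) ^ k / h) \<longlongrightarrow> 0) (at 0)"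
    proof (rule tendsto_rabs_zero_cancel, rule tendsto_sandwich[of "\<lambda>_. 0" _ _ "\<lambda>h. \<bar>h\<bar> ^ (k - 1)"])
      show "eventually (\<lambda>h::real. \<bar>max 0 h ^ k / h\<bar> \<le> \<bar>h\<bar> ^ (k - 1)) (at 0)"
      proof (rule always_eventually, rule allI)
        fix h :: real
        have "max 0 h ^ k \<le> \<bar>h\<bar> ^ k" by (intro power_mono) auto
        also have "\<dots> = \<bar>h\<bar> ^ (k - 1) * \<bar>h\<bar>" using assms by (simp flip: power_Suc2)
        finally show "\<bar>max 0 h ^ k / h\<bar> \<le> \<bar>h\<bar> ^ (k - 1)"
          by (cases "h = 0") (auto simp: field_simps abs_mult)
      qed
      have "((\<lambda>h::real. \<bar>h\<bar> ^ (k - 1)) \<longlongrightarrow> \<bar>0\<bar> ^ (k - 1)) (at 0)"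
        by (intro tendsto_intros)
      then show "((\<lambda>h::real. \<bar>h\<bar> ^ (k - 1)) \<longlongrightarrow> 0) (at 0)" using assms by (simp add: power_0_left)
    qed auto
    then show ?thesis using 3 assms by (simp add: DERIV_def power_0_left)
  qed
qed

lemma has_derivative_bump_power:
  fixes x :: "'a::real_inner"
  assumes "k \<ge> 2"
  shows "((\<lambda>x. bump r x ^ k) has_derivative (\<lambda>h. - 2 * real k * bump r x ^ (k - 1) * (x \<bullet> h))) (at x)"
proof -
  have norm_der: "((\<lambda>x. r\<^sup>2 - (norm x)\<^sup>2) has_derivative (\<lambda>h. - 2 * (x \<bullet> h))) (at x)"
    unfolding power2_norm_eq_inner by (auto intro!: derivative_eq_intros simp: inner_commute)
  show ?thesis
    unfolding bump_def
    using has_derivative_compose[OF norm_der has_real_derivative_max_power[OF assms, unfolded has_field_derivative_def]]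
    by (simp add: algebra_simps)
qed

section \<open>Identities for weighted integrals\<close>

definition bump_int :: "nat \<Rightarrow> ('a::euclidean_space \<Rightarrow> real) \<Rightarrow> real \<Rightarrow> real" where
  "bump_int k f r = integral UNIV (\<lambda>x. bump r x ^ k * f x)"

lemma bump_integrable:
  fixes f :: "'a::euclidean_space \<Rightarrow> real"
  assumes "blip_on (ball 0 1) f" "0 \<le> r" "r \<le> 1" "k \<ge> 1"
  shows "(\<lambda>x. bump r x ^ k * f x) integrable_on UNIV"
proof (rule continuous_compact_support_integrable[where R = r])
  show "continuous_on UNIV (\<lambda>x. bump r x ^ k * f x)"
    by (intro blip_on_continuous blip_on_bump_mult assms)
  show "bump r x ^ k * f x = 0" if "norm x > r" for x
    using that assms bump_outside[of r x] by simp
qed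

text \<open>Each component of the field \<open>bump r x ^ k *\<^sub>R F x\<close> is Lipschitz with
  compact support, so its partial derivative integrates to zero. Summing over the basis gives the
  divergence theorem, with the gradient of the weight supplying the right-hand side.\<close>

lemma weighted_divergence:
  fixes F :: "'a::euclidean_space \<Rightarrow> 'a"
  assumes F: "blip_on (ball 0 1) F" and r: "0 < r" "r < 1" and k: "k \<ge> 2" and N: "negligible N"
    and der: "\<And>x. x \<in> ball 0 1 \<Longrightarrow> x \<notin> N \<Longrightarrow> (F has_derivative F' x) (at x)"
  shows "((\<lambda>x. bump r x ^ k * (\<Sum>b\<in>Basis. F' x b \<bullet> b))
            has_integral 2 * real k * bump_int (k - 1) (\<lambda>x. x \<bullet> F x) r) UNIV"
proof -
  have comp: "((\<lambda>x. bump r x ^ k * (F' x b \<bullet> b) - 2 * real k * bump r x ^ (k - 1) * (x \<bullet> b) * (F x \<bullet> b))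
           has_integral 0) UNIV" (is "(?g has_integral 0) UNIV") if b: "b \<in> Basis" for b
  proof -
    let ?f = "\<lambda>x. bump r x ^ k * (F x \<bullet> b)"
    \<comment> \<open>Outside the unit ball \<open>F'\<close> is unconstrained, but the product is
      locally zero there, so the derivative is set to zero.\<close>
    let ?f' = "\<lambda>x h. if x \<in> ball 0 1 then bump r x ^ k * (F' x h \<bullet> b) + - 2 * real k * bump r x ^ (k - 1) * (x \<bullet> h) * (F x \<bullet> b) else 0"
    have "blip_on UNIV ?f"
      by (intro blip_on_bump_mult blip_on_inner F blip_on_const) (use r k in auto)
    then obtain L where L: "\<forall>x\<in>UNIV. \<forall>y\<in>UNIV. norm (?f x - ?f y) \<le> L * norm (x - y)"
      by (rule blip_onE)
    have "((\<lambda>x. ?f' x b) has_integral 0) UNIV"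
    proof (rule has_integral_directional_derivative_zero[where R = r and f = ?f and f' = ?f' and N = N])
      show "\<bar>?f x - ?f y\<bar> \<le> L * norm (x - y)" for x y using L by simp
      show "?f x = 0" if "norm x > r" for x using that r k bump_outside[of r x] by simp
      show "(?f has_derivative ?f' x) (at x)" if "x \<notin> N" for x
      proof (cases "x \<in> ball 0 1")
        case True
        have "(?f has_derivative (\<lambda>h. bump r x ^ k * (F' x h \<bullet> b) + - 2 * real k * bump r x ^ (k - 1) * (x \<bullet> h) * (F x \<bullet> b))) (at x)"
          by (rule has_derivative_mult[OF has_derivative_bump_power[OF k] has_derivative_inner_left[OF der[OF True that]]])
        then show ?thesis using True by simp
      next
        case False
        then have x: "x \<in> - cball 0 r" using r by simp
        have "((\<lambda>x. 0) has_derivative (\<lambda>h. 0)) (at x)" by simp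
        then have "(?f has_derivative (\<lambda>h. 0)) (at x)"
          by (rule has_derivative_transform_within_open[where s = "- cball 0 r"])
             (use x r k in \<open>auto simp: bump_outside\<close>)
        then show ?thesis using False by simp
      qed
    qed (fact N)
    moreover have "?f' x b = ?g x" for x
      using r k bump_outside[of r x] by (auto simp: power_0_left)
    ultimately show ?thesis by simp
  qed
  have "((\<lambda>x. \<Sum>b\<in>Basis. bump r x ^ k * (F' x b \<bullet> b) - 2 * real k * bump r x ^ (k - 1) * (x \<bullet> b) * (F x \<bullet> b))
           has_integral (\<Sum>b\<in>(Basis::'a set). 0)) UNIV"
    by (rule has_integral_sum) (use comp in auto)
  moreover have "(\<Sum>b\<in>Basis. bump r x ^ k * (F' x b \<bullet> b) - 2 * real k * bump r x ^ (k - 1) * (x \<bullet> b) * (F x \<bullet> b))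
      = bump r x ^ k * (\<Sum>b\<in>Basis. F' x b \<bullet> b) - 2 * real k * (bump r x ^ (k - 1) * (x \<bullet> F x))" for x
    by (simp add: euclidean_inner[of x "F x"] sum_subtractf sum_distrib_left algebra_simps)
  ultimately have 1: "((\<lambda>x. bump r x ^ k * (\<Sum>b\<in>Basis. F' x b \<bullet> b) - 2 * real k * (bump r x ^ (k - 1) * (x \<bullet> F x)))
      has_integral 0) UNIV" by simp
  have "((\<lambda>x. bump r x ^ (k - 1) * (x \<bullet> F x)) has_integral bump_int (k - 1) (\<lambda>x. x \<bullet> F x) r) UNIV"
    unfolding bump_int_def
    by (intro integrable_integral bump_integrable blip_on_inner F blip_on_id) (use r k in auto)
  from has_integral_add[OF 1 has_integral_mult_right[OF this, of "2 * real k"]]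
  show ?thesis by simp
qed

text \<open>Only the weight depends on the radius, so differentiation under the integral needs no
  smoothness of \<open>f\<close> and leaves no boundary term.\<close>

lemma bump_int_has_derivative:
  fixes f :: "'a::euclidean_space \<Rightarrow> real"
  assumes f: "blip_on (ball 0 1) f" and r: "0 < r" "r < 1" and k: "k \<ge> 2"
  shows "(bump_int k f has_real_derivative 2 * real k * r * bump_int (k - 1) f r) (at r)"
proof -
  obtain R where R: "r < R" "R < 1" using dense r by blast
  obtain a where a: "cball 0 1 \<subseteq> cbox (-a) (a::'a)"
    using bounded_subset_cbox_symmetric[of "cball 0 1"] bounded_cball by blast
  \<comment> \<open>The Leibniz rule wants a continuous integrand on a fixed box, and
    \<open>f\<close> may be discontinuous outside the unit ball. Projecting onto
    \<open>cball 0 R\<close> first gives a continuous \<open>g\<close> that agrees with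
    \<open>f\<close> wherever a weight of radius below \<open>R\<close> is non-zero.\<close>
  define g where "g = f \<circ> closest_point (cball 0 R)"
  have "cball (0::'a) R \<noteq> {}" using r R by simp
  then have cp: "closest_point (cball 0 R) x \<in> cball (0::'a) R" for x
    by (intro closest_point_in_set) auto
  have "closest_point (cball 0 R) x \<in> ball (0::'a) 1" for x
    using R(2) cp[of x] by simp
  then have "range (closest_point (cball 0 R)) \<subseteq> ball (0::'a) 1" by blast
  then have g_cont: "continuous_on UNIV g"
    unfolding g_def using r R
    by (intro continuous_on_compose continuous_on_closest_point continuous_on_subset[OF blip_on_continuous[OF f]])
       auto
  have fg: "bump s x ^ m * f x = bump s x ^ m * g x" if "0 < s" "s < R" "m \<ge> 1" for s x m
  proof (cases "x \<in> cball 0 R")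
    case True
    then show ?thesis by (simp add: g_def closest_point_self)
  next
    case False
    then show ?thesis using that bump_outside[of s x] by simp
  qed
  have J: "bump_int m f s = integral (cbox (-a) a) (\<lambda>x. bump s x ^ m * g x)" if "0 < s" "s < R" "m \<ge> 1" for s m
  proof -
    have "bump s x ^ m * f x = 0" if "x \<notin> cbox (-a) a" for x
    proof -
      have "x \<notin> cball 0 1" using a that by blast
      then show ?thesis using \<open>0 < s\<close> \<open>s < R\<close> \<open>R < 1\<close> \<open>m \<ge> 1\<close> bump_outside[of s x] by simp
    qed
    then have eq: "(\<lambda>x. bump s x ^ m * f x) = (\<lambda>x. if x \<in> cbox (-a) a then bump s x ^ m * f x else 0)" by auto
    have "integral UNIV (\<lambda>x. bump s x ^ m * f x) = integral (cbox (-a) a) (\<lambda>x. bump s x ^ m * f x)"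
      by (rule trans[OF arg_cong[OF eq, of "integral UNIV"] integral_restrict_UNIV])
    then show ?thesis unfolding bump_int_def by (simp only: fg[OF that])
  qed
  have "((\<lambda>s. integral (cbox (-a) a) (\<lambda>x. bump s x ^ k * g x)) has_real_derivative
      integral (cbox (-a) a) (\<lambda>x. 2 * real k * r * (bump r x ^ (k - 1) * g x))) (at r within {0<..<R})"
  proof (rule leibniz_rule_field_derivative[where fx = "\<lambda>s x. 2 * real k * s * (bump s x ^ (k - 1) * g x)"])
    fix s :: real and x :: 'a
    have "((\<lambda>s. bump s x ^ k) has_real_derivative real k * (bump s x ^ (k - 1)) * (2 * s)) (at s)"
      unfolding bump_def
      by (rule DERIV_chain2[OF has_real_derivative_max_power[OF k]]) (auto intro!: derivative_eq_intros)
    from DERIV_cmult_right[OF this, of "g x"]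
    show "((\<lambda>s. bump s x ^ k * g x) has_field_derivative 2 * real k * s * (bump s x ^ (k - 1) * g x)) (at s within {0<..<R})"
      by (auto intro: has_field_derivative_at_within simp: algebra_simps)
  next
    fix s :: real
    show "(\<lambda>x. bump s x ^ k * g x) integrable_on cbox (- a) a"
      unfolding bump_def
      by (intro integrable_continuous continuous_intros continuous_on_subset[OF g_cont]) auto
  next
    show "continuous_on ({0<..<R} \<times> cbox (- a) a) (\<lambda>(s, x). 2 * real k * s * (bump s x ^ (k - 1) * g x))"
      unfolding bump_def split_beta
      by (intro continuous_intros continuous_on_compose2[OF g_cont]) auto
  qed (use r R in auto)
  then have "((\<lambda>s. integral (cbox (-a) a) (\<lambda>x. bump s x ^ k * g x)) has_real_derivative
      2 * real k * r * bump_int (k - 1) f r) (at r)"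
    using r R k at_within_open[of r "{0<..<R}"] by (simp add: J)
  then show ?thesis
    by (rule has_field_derivative_transform_within_open[where S = "{0<..<R}"]) (use r R k J in auto)
qed

text \<open>Euler's identity for the dilation of the ball, obtained from the vector field \<open>f x *\<^sub>R x\<close>
  together with \<open>(norm x)\<^sup>2 = r\<^sup>2 - bump r x\<close> on the support of the bump.\<close>

lemma bump_int_dilation:
  fixes f :: "'a::euclidean_space \<Rightarrow> real"
  assumes f: "blip_on (ball 0 1) f" and r: "0 < r" "r < 1" and k: "k \<ge> 2" and N: "negligible N"
    and der: "\<And>x. x \<in> ball 0 1 \<Longrightarrow> x \<notin> N \<Longrightarrow> (f has_derivative f' x) (at x)"
  shows "((\<lambda>x. bump r x ^ k * f' x x) has_integral
           2 * real k * r\<^sup>2 * bump_int (k - 1) f r - (real DIM('a) + 2 * real k) * bump_int k f r) UNIV"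
proof -
  have "((\<lambda>x. f x *\<^sub>R x) has_derivative (\<lambda>h. f x *\<^sub>R h + f' x h *\<^sub>R x)) (at x)"
    if "x \<in> ball 0 1" "x \<notin> N" for x
    by (rule has_derivative_scaleR[OF der[OF that] has_derivative_ident])
  then have "((\<lambda>x. bump r x ^ k * (\<Sum>b\<in>Basis. (f x *\<^sub>R b + f' x b *\<^sub>R x) \<bullet> b)) has_integral
      2 * real k * bump_int (k - 1) (\<lambda>x. x \<bullet> f x *\<^sub>R x) r) UNIV"
    by (intro weighted_divergence[where N = N] r k N blip_on_scaleR f blip_on_id) auto
  then have 1: "((\<lambda>x. bump r x ^ k * (\<Sum>b\<in>Basis. (f x *\<^sub>R b + f' x b *\<^sub>R x) \<bullet> b) - real DIM('a) * (bump r x ^ k * f x)) has_integral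
      2 * real k * bump_int (k - 1) (\<lambda>x. x \<bullet> f x *\<^sub>R x) r - real DIM('a) * bump_int k f r) UNIV"
    unfolding bump_int_def
    by (intro has_integral_diff has_integral_mult_right integrable_integral bump_integrable f) (use r k in auto)
  have 2: "bump r x ^ k * (\<Sum>b\<in>Basis. (f x *\<^sub>R b + f' x b *\<^sub>R x) \<bullet> b) - real DIM('a) * (bump r x ^ k * f x)
     = bump r x ^ k * f' x x" if "x \<notin> N" for x
  proof (cases "x \<in> ball 0 1")
    case True
    then interpret f': bounded_linear "f' x" using der that by (blast intro: has_derivative_bounded_linear)
    have "f' x x = f' x (\<Sum>b\<in>Basis. (x \<bullet> b) *\<^sub>R b)" by (simp add: euclidean_representation)
    also have "\<dots> = (\<Sum>b\<in>Basis. f' x b * (x \<bullet> b))" by (simp add: f'.sum f'.scaleR mult.commute)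
    finally show ?thesis by (simp add: inner_add_left sum.distrib algebra_simps)
  next
    case False
    then show ?thesis using r k bump_outside[of r x] by (simp add: power_0_left)
  qed
  have 3: "((\<lambda>x. bump r x ^ k * f' x x) has_integral
     2 * real k * bump_int (k - 1) (\<lambda>x. x \<bullet> f x *\<^sub>R x) r - real DIM('a) * bump_int k f r) UNIV"
    by (rule has_integral_spike[OF N _ 1]) (use 2 in auto)
  have "bump_int (k - 1) (\<lambda>x. x \<bullet> f x *\<^sub>R x) r = integral UNIV (\<lambda>x. r\<^sup>2 * (bump r x ^ (k - 1) * f x) - bump r x ^ k * f x)"
    unfolding bump_int_def
  proof (rule integral_cong)
    fix x :: 'a
    have "bump r x ^ k = bump r x ^ (k - 1) * bump r x" using k by (simp flip: power_Suc2)
    moreover have "bump r x ^ (k - 1) * (norm x)\<^sup>2 = bump r x ^ (k - 1) * (r\<^sup>2 - bump r x)"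
      using r k bump_outside[of r x] bump_inside[of x r] by (cases "norm x \<le> r") auto
    moreover have "bump r x ^ (k - 1) * (x \<bullet> f x *\<^sub>R x) = f x * (bump r x ^ (k - 1) * (norm x)\<^sup>2)"
      by (simp add: power2_norm_eq_inner)
    ultimately show "bump r x ^ (k - 1) * (x \<bullet> f x *\<^sub>R x) = r\<^sup>2 * (bump r x ^ (k - 1) * f x) - bump r x ^ k * f x"
      by (simp only:) (simp add: algebra_simps)
  qed
  also have "\<dots> = r\<^sup>2 * bump_int (k - 1) f r - bump_int k f r"
    unfolding bump_int_def
    by (intro integral_unique has_integral_diff has_integral_mult_right integrable_integral bump_integrable f)
       (use r k in auto)
  finally have 4: "bump_int (k - 1) (\<lambda>x. x \<bullet> f x *\<^sub>R x) r = r\<^sup>2 * bump_int (k - 1) f r - bump_int k f r" .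
  show ?thesis using 3 unfolding 4 by (simp add: algebra_simps)
qed

section \<open>Symmetry of the second derivative at a single point\<close>

text \<open>The gradient is differentiable only almost everywhere, so continuity of second
  derivatives cannot be invoked. The second difference of \<open>w\<close> is symmetric in
  \<open>h\<close> and \<open>k\<close>; the mean value theorem and differentiability of
  \<open>G\<close> at the one point \<open>x\<close> identify its limit as
  \<open>H k \<bullet> h\<close>.\<close>

lemma symmetric_second_derivative:
  fixes w :: "'a::real_inner \<Rightarrow> real"
  assumes S: "open S" "x \<in> S"
    and w: "\<And>y. y \<in> S \<Longrightarrow> (w has_derivative (\<lambda>h. G y \<bullet> h)) (at y)"
    and G: "(G has_derivative H) (at x)"
  shows "H h \<bullet> k = H k \<bullet> h"
proof -
  interpret H: bounded_linear H using G by (rule has_derivative_bounded_linear)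
  have quotient: "((\<lambda>t. (w (x + t *\<^sub>R h + t *\<^sub>R k) - w (x + t *\<^sub>R h) - w (x + t *\<^sub>R k) + w x) / t\<^sup>2) \<longlongrightarrow> H k \<bullet> h) (at_right 0)"
    for h k
  proof (rule tendstoI)
    fix e :: real assume "e > 0"
    \<comment> \<open>Collects the final estimate: two remainders of \<open>G\<close>, each at most
      \<open>e' * t * (norm h + norm k + 1)\<close>, paired with \<open>h\<close>. The added ones
      keep \<open>c\<close> positive when \<open>h\<close> or \<open>k\<close> is zero.\<close>
    define c where "c = (norm h + norm k + 1) * (norm h + 1) * 2"
    have "c > 0" by (simp add: c_def add_nonneg_pos)
    define e' where "e' = e / (2 * c)"
    have "e' > 0" using \<open>e > 0\<close> \<open>c > 0\<close> by (simp add: e'_def)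
    obtain d1 where d1: "d1 > 0" "\<And>y. norm (y - x) < d1 \<Longrightarrow> norm (G y - G x - H (y - x)) \<le> e' * norm (y - x)"
      using G \<open>e' > 0\<close> unfolding has_derivative_at_alt by blast
    obtain d2 where d2: "d2 > 0" "ball x d2 \<subseteq> S" using S open_contains_ball by blast
    define d where "d = min d1 d2 / (norm h + norm k + 1)"
    have "d > 0" using d1 d2 by (simp add: d_def add_nonneg_pos)
    have main: "dist ((w (x + t *\<^sub>R h + t *\<^sub>R k) - w (x + t *\<^sub>R h) - w (x + t *\<^sub>R k) + w x) / t\<^sup>2) (H k \<bullet> h) < e"
      if t: "0 < t" "t < d" for t
    proof -
      have small: "norm (s *\<^sub>R h + s' *\<^sub>R k) < min d1 d2" "norm (s *\<^sub>R h + s' *\<^sub>R k) \<le> t * (norm h + norm k + 1)"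
        if "0 \<le> s" "s \<le> t" "0 \<le> s'" "s' \<le> t" for s s'
      proof -
        have "norm (s *\<^sub>R h + s' *\<^sub>R k) \<le> s * norm h + s' * norm k"
          using norm_triangle_ineq[of "s *\<^sub>R h" "s' *\<^sub>R k"] that by simp
        also have "\<dots> \<le> t * norm h + t * norm k"
          by (intro add_mono mult_right_mono) (use that in auto)
        finally show 1: "norm (s *\<^sub>R h + s' *\<^sub>R k) \<le> t * (norm h + norm k + 1)"
          using t by (simp add: algebra_simps)
        also have "\<dots> < d * (norm h + norm k + 1)"
          using t by (intro mult_strict_right_mono) (auto intro: add_nonneg_pos)
        also have "\<dots> = min d1 d2" by (simp add: d_def add_nonneg_eq_0_iff add_nonneg_pos less_imp_neq[symmetric])
        finally show "norm (s *\<^sub>R h + s' *\<^sub>R k) < min d1 d2" .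
      qed
      \<comment> \<open>The second difference is the increment over \<open>[0, t]\<close> of this
        first difference in direction \<open>k\<close>, to which the mean value theorem is applied
        in direction \<open>h\<close>.\<close>
      let ?g = "\<lambda>s. w (x + s *\<^sub>R h + t *\<^sub>R k) - w (x + s *\<^sub>R h)"
      let ?g' = "\<lambda>s. (G (x + s *\<^sub>R h + t *\<^sub>R k) - G (x + s *\<^sub>R h)) \<bullet> h"
      have "\<exists>\<xi>. 0 < \<xi> \<and> \<xi> < t \<and> ?g t - ?g 0 = (t - 0) * ?g' \<xi>"
      proof (rule MVT2)
        fix s assume s: "0 \<le> s" "s \<le> t"
        have inS: "x + s *\<^sub>R h + t *\<^sub>R k \<in> S" "x + s *\<^sub>R h \<in> S"
          using small(1)[OF s, of t] small(1)[OF s, of 0] t d2 by (auto simp: dist_norm subset_iff algebra_simps norm_minus_commute)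
        have "((\<lambda>s. w (x + s *\<^sub>R h + t *\<^sub>R k)) has_derivative (\<lambda>u. G (x + s *\<^sub>R h + t *\<^sub>R k) \<bullet> (u *\<^sub>R h))) (at s)"
          by (rule has_derivative_compose[of "\<lambda>s. x + s *\<^sub>R h + t *\<^sub>R k" "\<lambda>u. u *\<^sub>R h" s UNIV w, OF _ w[OF inS(1)]])
             (auto intro!: derivative_eq_intros)
        moreover have "((\<lambda>s. w (x + s *\<^sub>R h)) has_derivative (\<lambda>u. G (x + s *\<^sub>R h) \<bullet> (u *\<^sub>R h))) (at s)"
          by (rule has_derivative_compose[of "\<lambda>s. x + s *\<^sub>R h" "\<lambda>u. u *\<^sub>R h" s UNIV w, OF _ w[OF inS(2)]])
             (auto intro!: derivative_eq_intros)
        ultimately have "(?g has_derivative (\<lambda>u. G (x + s *\<^sub>R h + t *\<^sub>R k) \<bullet> (u *\<^sub>R h) - G (x + s *\<^sub>R h) \<bullet> (u *\<^sub>R h))) (at s)"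
          by (rule has_derivative_diff)
        then show "(?g has_real_derivative ?g' s) (at s)"
          unfolding has_field_derivative_def
          by (rule has_derivative_eq_rhs) (auto simp: inner_diff_left algebra_simps)
      qed (use t in auto)
      then obtain \<xi> where \<xi>: "0 < \<xi>" "\<xi> < t" "?g t - ?g 0 = t * ?g' \<xi>" by auto
      define A where "A = G (x + \<xi> *\<^sub>R h + t *\<^sub>R k) - G x - H (\<xi> *\<^sub>R h + t *\<^sub>R k)"
      define B where "B = G (x + \<xi> *\<^sub>R h) - G x - H (\<xi> *\<^sub>R h)"
      have bd: "e' * norm v \<le> e' * (t * (norm h + norm k + 1))" if "norm v \<le> t * (norm h + norm k + 1)" for v :: 'a
        using \<open>e' > 0\<close> that by simp
      have A: "norm A \<le> e' * (t * (norm h + norm k + 1))"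
        using d1(2)[of "x + \<xi> *\<^sub>R h + t *\<^sub>R k"] small[of \<xi> t] \<xi> t bd[of "\<xi> *\<^sub>R h + t *\<^sub>R k"]
        by (simp add: A_def algebra_simps)
      have B: "norm B \<le> e' * (t * (norm h + norm k + 1))"
        using d1(2)[of "x + \<xi> *\<^sub>R h"] small[of \<xi> 0] \<xi> t bd[of "\<xi> *\<^sub>R h"]
        by (simp add: B_def algebra_simps)
      have g': "?g' \<xi> = t * (H k \<bullet> h) + (A - B) \<bullet> h"
        by (simp add: A_def B_def H.add H.scaleR inner_diff_left inner_add_left)
      have "(w (x + t *\<^sub>R h + t *\<^sub>R k) - w (x + t *\<^sub>R h) - w (x + t *\<^sub>R k) + w x) = t\<^sup>2 * (H k \<bullet> h) + t * ((A - B) \<bullet> h)"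
        using \<xi>(3)[unfolded g'] by (simp add: algebra_simps power2_eq_square)
      then have "dist ((w (x + t *\<^sub>R h + t *\<^sub>R k) - w (x + t *\<^sub>R h) - w (x + t *\<^sub>R k) + w x) / t\<^sup>2) (H k \<bullet> h) = \<bar>(A - B) \<bullet> h\<bar> / t"
        using t by (simp add: dist_real_def add_divide_distrib power2_eq_square)
      also have "\<dots> \<le> (norm A + norm B) * (norm h + 1) / t"
      proof (rule divide_right_mono)
        have "\<bar>(A - B) \<bullet> h\<bar> \<le> norm (A - B) * norm h" by (rule Cauchy_Schwarz_ineq2)
        also have "\<dots> \<le> (norm A + norm B) * (norm h + 1)"
          by (intro mult_mono norm_triangle_ineq4) auto
        finally show "\<bar>(A - B) \<bullet> h\<bar> \<le> (norm A + norm B) * (norm h + 1)" .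
      qed (use t in auto)
      also have "\<dots> \<le> (2 * (e' * (t * (norm h + norm k + 1)))) * (norm h + 1) / t"
        by (intro divide_right_mono mult_right_mono) (use A B t in auto)
      also have "\<dots> = e' * c" using t by (simp add: c_def)
      also have "\<dots> < e" using \<open>c > 0\<close> \<open>e > 0\<close> by (simp add: e'_def)
      finally show ?thesis .
    qed
    show "\<forall>\<^sub>F t in at_right 0. dist ((w (x + t *\<^sub>R h + t *\<^sub>R k) - w (x + t *\<^sub>R h) - w (x + t *\<^sub>R k) + w x) / t\<^sup>2) (H k \<bullet> h) < e"
      using main \<open>d > 0\<close> eventually_at_right_field by blast
  qed
  have "((\<lambda>t. (w (x + t *\<^sub>R h + t *\<^sub>R k) - w (x + t *\<^sub>R h) - w (x + t *\<^sub>R k) + w x) / t\<^sup>2) \<longlongrightarrow> H h \<bullet> k) (at_right 0)"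
    using quotient[of k h] by (simp add: algebra_simps)
  with quotient[of h k] show ?thesis
    using tendsto_unique trivial_limit_at_right_real by blast
qed

section \<open>The Weiss and Monneau functionals\<close>

lemma bump_int_nonneg_ae:
  fixes f :: "'a::euclidean_space \<Rightarrow> real"
  assumes f: "((\<lambda>x. bump r x ^ k * f x) has_integral I) UNIV" and r: "0 < r" "r < 1" and k: "k \<ge> 1" and N: "negligible N"
    and nonneg: "\<And>x. x \<in> ball 0 1 \<Longrightarrow> x \<notin> N \<Longrightarrow> 0 \<le> f x"
  shows "0 \<le> I"
proof -
  have "((\<lambda>x. if x \<in> N then 0 else bump r x ^ k * f x) has_integral I) UNIV"
    by (rule has_integral_spike[OF N _ f]) auto
  then show ?thesis
  proof (rule has_integral_nonneg)
    fix x :: 'a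
    show "0 \<le> (if x \<in> N then 0 else bump r x ^ k * f x)"
      using nonneg[of x] bump_outside[of r x] r k by (cases "x \<in> ball 0 1") (auto simp: power_0_left)
  qed
qed

lemma bump_int_has_integral:
  fixes f :: "'a::euclidean_space \<Rightarrow> real"
  assumes "blip_on (ball 0 1) f" "0 < r" "r < 1" "k \<ge> 1"
  shows "((\<lambda>x. bump r x ^ k * f x) has_integral bump_int k f r) UNIV"
  unfolding bump_int_def using assms by (intro integrable_integral bump_integrable) auto

lemma bump_int_scaled_has_derivative:
  fixes f :: "'a::euclidean_space \<Rightarrow> real"
  assumes f: "blip_on (ball 0 1) f" and r: "0 < r" "r < 1" and k: "k \<ge> 2"
  shows "((\<lambda>r. bump_int k f r / r ^ m) has_real_derivative
     (2 * real k * r\<^sup>2 * bump_int (k - 1) f r - real m * bump_int k f r) / r ^ (m + 1)) (at r)"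
proof (cases m)
  case 0
  then show ?thesis using bump_int_has_derivative[OF assms] r by (simp add: power2_eq_square field_simps)
next
  case (Suc j)
  show ?thesis
    by (rule derivative_eq_intros bump_int_has_derivative[OF assms] refl)+
       (use r Suc in \<open>auto simp: field_simps power2_eq_square\<close>)
qed

section \<open>Functionals of a function with Lipschitz gradient\<close>

text \<open>No equation is assumed, so the identities serve both the solution minus a quadratic and
  the quadratic itself, for which \<open>N\<close> is empty.\<close>

locale gradient_lipschitz =
  fixes w :: "'a::euclidean_space \<Rightarrow> real" and G :: "'a \<Rightarrow> 'a" and H :: "'a \<Rightarrow> 'a \<Rightarrow> 'a"
    and N :: "'a set" and L :: real
  assumes w_der: "\<And>x. x \<in> ball 0 1 \<Longrightarrow> (w has_derivative (\<lambda>h. G x \<bullet> h)) (at x)"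
    and G_lip: "\<And>x y. x \<in> ball 0 1 \<Longrightarrow> y \<in> ball 0 1 \<Longrightarrow> norm (G x - G y) \<le> L * norm (x - y)"
    and N: "negligible N"
    and G_der: "\<And>x. x \<in> ball 0 1 \<Longrightarrow> x \<notin> N \<Longrightarrow> (G has_derivative H x) (at x)"
begin

definition lap :: "'a \<Rightarrow> real" where
  "lap x = (\<Sum>b\<in>Basis. H x b \<bullet> b)"

text \<open>The defect in Euler's relation for functions homogeneous of degree two.\<close>

definition euler :: "'a \<Rightarrow> real" where
  "euler x = x \<bullet> G x - 2 * w x"

text \<open>Both functionals are written without rescaling: the power \<open>r ^ (DIM('a) + 8)\<close> is what the
  substitution \<open>x = r y\<close> produces for the blow-up \<open>w (r y) / r\<^sup>2\<close> and the weights \<open>(1 - (norm y)\<^sup>2) ^ 3\<close>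
  and \<open>(1 - (norm y)\<^sup>2)\<^sup>2\<close>.\<close>

definition weiss :: "real \<Rightarrow> real" where
  "weiss r = (bump_int 3 (\<lambda>x. G x \<bullet> G x) r - 12 * bump_int 2 (\<lambda>x. w x * w x) r) / r ^ (DIM('a) + 8)"

definition monneau :: "real \<Rightarrow> real" where
  "monneau r = bump_int 2 (\<lambda>x. w x * w x) r / r ^ (DIM('a) + 8)"

lemma blip_G: "blip_on (ball 0 1) G"
proof (rule blip_onI)
  fix x :: 'a assume x: "x \<in> ball 0 1"
  have "norm (G x) \<le> norm (G 0) + norm (G x - G 0)" by (metis add.commute diff_add_cancel norm_triangle_ineq)
  also have "norm (G x - G 0) \<le> \<bar>L\<bar> * norm x"
    using G_lip[OF x, of 0] mult_right_mono[OF abs_ge_self[of L] norm_ge_zero[of x]] by simp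
  also have "\<dots> \<le> \<bar>L\<bar>" using x by (simp add: mult_left_le)
  finally show "norm (G x) \<le> norm (G 0) + \<bar>L\<bar>" by simp
qed (rule G_lip)

lemma blip_w: "blip_on (ball 0 1) w"
proof -
  obtain B where B: "\<forall>x\<in>ball 0 1. norm (G x) \<le> B" using blip_G by (rule blip_onE)
  have lip: "norm (w x - w y) \<le> B * norm (x - y)" if "x \<in> ball 0 1" "y \<in> ball 0 1" for x y
  proof (rule differentiable_bound[where S = "ball 0 1" and f' = "\<lambda>x h. G x \<bullet> h"])
    fix z :: 'a assume z: "z \<in> ball 0 1"
    show "(w has_derivative (\<lambda>h. G z \<bullet> h)) (at z within ball 0 1)"
      using w_der[OF z] by (rule has_derivative_at_withinI)
    have "\<bar>G z \<bullet> h\<bar> \<le> B * norm h" for h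
      using Cauchy_Schwarz_ineq2[of "G z" h] B z mult_right_mono[of "norm (G z)" B "norm h"] by force
    then show "onorm (\<lambda>h. G z \<bullet> h) \<le> B"
      by (intro onorm_le) auto
  qed (use that in auto)
  show ?thesis
  proof (rule blip_onI)
    fix x :: 'a assume x: "x \<in> ball 0 1"
    have "B \<ge> 0" using B by (meson centre_in_ball norm_ge_zero order_trans zero_less_one)
    then have "B * norm x \<le> B" using x by (simp add: mult_left_le)
    then show "norm (w x) \<le> \<bar>w 0\<bar> + B"
      using lip[OF x, of 0] by simp
  qed (rule lip)
qed

lemma blip_euler: "blip_on (ball 0 1) euler"
  unfolding euler_def
  by (intro blip_on_diff blip_on_inner blip_on_mult blip_on_const blip_G blip_w blip_on_id bounded_ball)

lemmas blips = blip_on_inner blip_on_mult blip_on_scaleR blip_G blip_w blip_euler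

text \<open>Apply the divergence identity to \<open>w x *\<^sub>R G x\<close>. The weight of
  exponent three yields the factor 6, and \<open>x \<bullet> G x = euler x + 2 * w x\<close> turns
  it into the 12 of the Weiss functional: the bracket is precisely what vanishes when
  \<open>lap\<close> and \<open>euler\<close> do.\<close>

lemma has_integral_w_lap:
  assumes r: "0 < r" "r < 1"
  shows "((\<lambda>x. bump r x ^ 3 * (w x * lap x)) has_integral
     6 * bump_int 2 (\<lambda>x. w x * euler x) r
       - (bump_int 3 (\<lambda>x. G x \<bullet> G x) r - 12 * bump_int 2 (\<lambda>x. w x * w x) r)) UNIV"
proof -
  have "((\<lambda>x. w x *\<^sub>R G x) has_derivative (\<lambda>h. w x *\<^sub>R H x h + (G x \<bullet> h) *\<^sub>R G x)) (at x)"
    if "x \<in> ball 0 1" "x \<notin> N" for x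
    by (rule has_derivative_scaleR[OF w_der[OF that(1)] G_der[OF that]])
  then have "((\<lambda>x. bump r x ^ 3 * (\<Sum>b\<in>Basis. (w x *\<^sub>R H x b + (G x \<bullet> b) *\<^sub>R G x) \<bullet> b)) has_integral
      2 * real 3 * bump_int (3 - 1) (\<lambda>x. x \<bullet> w x *\<^sub>R G x) r) UNIV"
    by (intro weighted_divergence[where N = N] r N blips) auto
  moreover have "(\<Sum>b\<in>Basis. (w x *\<^sub>R H x b + (G x \<bullet> b) *\<^sub>R G x) \<bullet> b) = w x * lap x + G x \<bullet> G x" for x
    by (simp add: lap_def inner_add_left sum.distrib sum_distrib_left euclidean_inner[of "G x" "G x"])
  ultimately have 1: "((\<lambda>x. bump r x ^ 3 * (w x * lap x + G x \<bullet> G x)) has_integral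
      6 * bump_int 2 (\<lambda>x. x \<bullet> w x *\<^sub>R G x) r) UNIV" by simp
  have "((\<lambda>x. bump r x ^ 2 * (w x * euler x) + 2 * (bump r x ^ 2 * (w x * w x))) has_integral
     bump_int 2 (\<lambda>x. w x * euler x) r + 2 * bump_int 2 (\<lambda>x. w x * w x) r) UNIV"
    by (intro has_integral_add has_integral_mult_right bump_int_has_integral blips r) auto
  then have 2: "bump_int 2 (\<lambda>x. x \<bullet> w x *\<^sub>R G x) r = bump_int 2 (\<lambda>x. w x * euler x) r + 2 * bump_int 2 (\<lambda>x. w x * w x) r"
    by (subst bump_int_def, intro integral_unique) (simp add: euler_def algebra_simps)
  have "((\<lambda>x. bump r x ^ 3 * (G x \<bullet> G x)) has_integral bump_int 3 (\<lambda>x. G x \<bullet> G x) r) UNIV"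
    by (intro bump_int_has_integral blips r) auto
  from has_integral_diff[OF 1 this] show ?thesis
    unfolding 2 by (simp add: algebra_simps)
qed

text \<open>Differentiation in \<open>r\<close> and the dilation identity for
  \<open>w x * w x\<close> leave only the integral of \<open>w x * euler x\<close>;
  \<open>has_integral_w_lap\<close> trades it for the Weiss functional and the Laplacian
  term.\<close>

lemma monneau_has_derivative:
  assumes r: "0 < r" "r < 1"
  shows "(monneau has_real_derivative
     weiss r / (3 * r) + integral UNIV (\<lambda>x. bump r x ^ 3 * (w x * lap x)) / (3 * r ^ (DIM('a) + 9))) (at r)"
proof -
  let ?n = "real DIM('a)"
  have der: "((\<lambda>x. w x * w x) has_derivative (\<lambda>h. w x * (G x \<bullet> h) + (G x \<bullet> h) * w x)) (at x)"
    if "x \<in> ball 0 1" for x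
    by (rule has_derivative_mult[OF w_der[OF that] w_der[OF that]])
  have 1: "((\<lambda>x. bump r x ^ 2 * (w x * (G x \<bullet> x) + (G x \<bullet> x) * w x)) has_integral
     2 * real 2 * r\<^sup>2 * bump_int (2 - 1) (\<lambda>x. w x * w x) r - (?n + 2 * real 2) * bump_int 2 (\<lambda>x. w x * w x) r) UNIV"
    by (intro bump_int_dilation[where N = "{}"] blips r der) auto
  have "((\<lambda>x. 2 * (bump r x ^ 2 * (w x * euler x)) + 4 * (bump r x ^ 2 * (w x * w x))) has_integral
     2 * bump_int 2 (\<lambda>x. w x * euler x) r + 4 * bump_int 2 (\<lambda>x. w x * w x) r) UNIV"
    by (intro has_integral_add has_integral_mult_right bump_int_has_integral blips r) auto
  then have 2: "((\<lambda>x. bump r x ^ 2 * (w x * (G x \<bullet> x) + (G x \<bullet> x) * w x)) has_integral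
     2 * bump_int 2 (\<lambda>x. w x * euler x) r + 4 * bump_int 2 (\<lambda>x. w x * w x) r) UNIV"
    by (simp add: euler_def algebra_simps inner_commute)
  \<comment> \<open>Here the power in \<open>monneau\<close> is decisive: of the constant
    \<open>DIM('a) + 8\<close>, dilation supplies \<open>DIM('a) + 4\<close> and the relation
    \<open>x \<bullet> G x = euler x + 2 * w x\<close> the remaining 4.\<close>
  have 3: "4 * r\<^sup>2 * bump_int 1 (\<lambda>x. w x * w x) r - (?n + 8) * bump_int 2 (\<lambda>x. w x * w x) r
      = 2 * bump_int 2 (\<lambda>x. w x * euler x) r"
    using has_integral_unique[OF 1 2] by (simp add: algebra_simps)
  have 4: "6 * bump_int 2 (\<lambda>x. w x * euler x) r = integral UNIV (\<lambda>x. bump r x ^ 3 * (w x * lap x)) + weiss r * r ^ (DIM('a) + 8)"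
    using integral_unique[OF has_integral_w_lap[OF r]] r by (simp add: weiss_def)
  have "(monneau has_real_derivative
     (2 * real 2 * r\<^sup>2 * bump_int (2 - 1) (\<lambda>x. w x * w x) r - real (DIM('a) + 8) * bump_int 2 (\<lambda>x. w x * w x) r) / r ^ (DIM('a) + 8 + 1)) (at r)"
    unfolding monneau_def[abs_def] by (intro bump_int_scaled_has_derivative blips r) auto
  also have "(2 * real 2 * r\<^sup>2 * bump_int (2 - 1) (\<lambda>x. w x * w x) r - real (DIM('a) + 8) * bump_int 2 (\<lambda>x. w x * w x) r)
      = 2 * bump_int 2 (\<lambda>x. w x * euler x) r"
    using 3 by (simp add: algebra_simps)
  also have "\<dots> = (integral UNIV (\<lambda>x. bump r x ^ 3 * (w x * lap x)) + weiss r * r ^ (DIM('a) + 8)) / 3"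
    using 4 by simp
  finally show ?thesis
    by (rule DERIV_cong) (use r in \<open>simp add: field_simps power_add eval_nat_numeral\<close>)
qed

text \<open>A Rellich-type identity, from the field \<open>euler x *\<^sub>R G x\<close>. Its
  divergence contains \<open>x \<bullet> H x (G x)\<close>, which by symmetry of \<open>H x\<close>
  is half the radial derivative of \<open>G x \<bullet> G x\<close>, and the dilation identity
  integrates that.\<close>

lemma has_integral_euler_lap:
  assumes r: "0 < r" "r < 1"
  shows "((\<lambda>x. bump r x ^ 3 * (euler x * lap x)) has_integral
     6 * bump_int 2 (\<lambda>x. euler x * euler x) r + 12 * bump_int 2 (\<lambda>x. w x * euler x) r
      - (3 * r\<^sup>2 * bump_int 2 (\<lambda>x. G x \<bullet> G x) r - (real DIM('a) / 2 + 4) * bump_int 3 (\<lambda>x. G x \<bullet> G x) r)) UNIV"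
proof -
  let ?n = "real DIM('a)"
  have "((\<lambda>x. G x \<bullet> G x) has_derivative (\<lambda>h. G x \<bullet> H x h + H x h \<bullet> G x)) (at x)"
    if "x \<in> ball 0 1" "x \<notin> N" for x
    by (rule has_derivative_inner[OF G_der[OF that] G_der[OF that]])
  then have 1: "((\<lambda>x. bump r x ^ 3 * (G x \<bullet> H x x + H x x \<bullet> G x)) has_integral
     2 * real 3 * r\<^sup>2 * bump_int (3 - 1) (\<lambda>x. G x \<bullet> G x) r - (?n + 2 * real 3) * bump_int 3 (\<lambda>x. G x \<bullet> G x) r) UNIV"
    by (intro bump_int_dilation[where N = N] blips r N) auto
  have "(euler has_derivative (\<lambda>h. x \<bullet> H x h - G x \<bullet> h)) (at x)"
    if "x \<in> ball 0 1" "x \<notin> N" for x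
    unfolding euler_def[abs_def]
    by (rule derivative_eq_intros G_der[OF that] w_der[OF that(1)] refl)+ (simp add: fun_eq_iff inner_commute)
  from has_derivative_scaleR[OF this G_der]
  have "((\<lambda>x. euler x *\<^sub>R G x) has_derivative (\<lambda>h. euler x *\<^sub>R H x h + (x \<bullet> H x h - G x \<bullet> h) *\<^sub>R G x)) (at x)"
    if "x \<in> ball 0 1" "x \<notin> N" for x using that by blast
  then have "((\<lambda>x. bump r x ^ 3 * (\<Sum>b\<in>Basis. (euler x *\<^sub>R H x b + (x \<bullet> H x b - G x \<bullet> b) *\<^sub>R G x) \<bullet> b)) has_integral
      2 * real 3 * bump_int (3 - 1) (\<lambda>x. x \<bullet> euler x *\<^sub>R G x) r) UNIV"
    by (intro weighted_divergence[where N = N] r N blips) auto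
  then have 2: "((\<lambda>x. bump r x ^ 3 * (euler x * lap x + (G x \<bullet> H x x + H x x \<bullet> G x) / 2 - G x \<bullet> G x)) has_integral
      2 * real 3 * bump_int (3 - 1) (\<lambda>x. x \<bullet> euler x *\<^sub>R G x) r) UNIV"
  proof (rule has_integral_spike[OF N, rotated])
    fix x assume x: "x \<in> UNIV - N"
    show "bump r x ^ 3 * (euler x * lap x + (G x \<bullet> H x x + H x x \<bullet> G x) / 2 - G x \<bullet> G x)
      = bump r x ^ 3 * (\<Sum>b\<in>Basis. (euler x *\<^sub>R H x b + (x \<bullet> H x b - G x \<bullet> b) *\<^sub>R G x) \<bullet> b)"
    proof (cases "x \<in> ball 0 1")
      case True
      interpret bounded_linear "H x"
        using G_der True x by (blast intro: has_derivative_bounded_linear)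
      have "H x (G x) = (\<Sum>b\<in>Basis. (G x \<bullet> b) *\<^sub>R H x b)"
        by (subst euclidean_representation[of "G x", symmetric]) (simp add: sum scaleR del: euclidean_representation)
      then have "x \<bullet> H x (G x) = (\<Sum>b\<in>Basis. (x \<bullet> H x b) * (G x \<bullet> b))"
        by (simp add: inner_sum_right mult.commute)
      moreover have "H x x \<bullet> G x = H x (G x) \<bullet> x"
        by (rule symmetric_second_derivative[where S = "ball 0 1" and w = w and G = G and x = x])
           (use True x w_der G_der in auto)
      moreover have "(\<Sum>b\<in>Basis. (euler x *\<^sub>R H x b + (x \<bullet> H x b - G x \<bullet> b) *\<^sub>R G x) \<bullet> b)
        = euler x * lap x + (\<Sum>b\<in>Basis. (x \<bullet> H x b) * (G x \<bullet> b)) - G x \<bullet> G x"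
        by (simp add: lap_def inner_add_left sum.distrib sum_subtractf sum_distrib_left
            euclidean_inner[of "G x" "G x"] left_diff_distrib)
      ultimately show ?thesis by (simp add: inner_commute)
    next
      case False
      then show ?thesis using r bump_outside[of r x] by simp
    qed
  qed
  have 3: "((\<lambda>x. bump r x ^ 3 * (G x \<bullet> G x)) has_integral bump_int 3 (\<lambda>x. G x \<bullet> G x) r) UNIV"
    by (intro bump_int_has_integral blips r) auto
  have "((\<lambda>x. bump r x ^ 2 * (euler x * euler x) + 2 * (bump r x ^ 2 * (w x * euler x))) has_integral
     bump_int 2 (\<lambda>x. euler x * euler x) r + 2 * bump_int 2 (\<lambda>x. w x * euler x) r) UNIV"
    by (intro has_integral_add has_integral_mult_right bump_int_has_integral blips r) auto
  moreover have "bump r x ^ 2 * (euler x * euler x) + 2 * (bump r x ^ 2 * (w x * euler x)) = bump r x ^ 2 * (x \<bullet> euler x *\<^sub>R G x)" for x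
    by (simp add: euler_def algebra_simps)
  ultimately have 4: "bump_int 2 (\<lambda>x. x \<bullet> euler x *\<^sub>R G x) r = bump_int 2 (\<lambda>x. euler x * euler x) r + 2 * bump_int 2 (\<lambda>x. w x * euler x) r"
    by (subst bump_int_def, intro integral_unique) simp
  have 5: "((\<lambda>x. bump r x ^ 3 * (euler x * lap x + (G x \<bullet> H x x + H x x \<bullet> G x) / 2 - G x \<bullet> G x)
        - (1/2) * (bump r x ^ 3 * (G x \<bullet> H x x + H x x \<bullet> G x)) + bump r x ^ 3 * (G x \<bullet> G x)) has_integral
      2 * real 3 * bump_int (3 - 1) (\<lambda>x. x \<bullet> euler x *\<^sub>R G x) r
        - (1/2) * (2 * real 3 * r\<^sup>2 * bump_int (3 - 1) (\<lambda>x. G x \<bullet> G x) r - (?n + 2 * real 3) * bump_int 3 (\<lambda>x. G x \<bullet> G x) r)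
        + bump_int 3 (\<lambda>x. G x \<bullet> G x) r) UNIV"
    by (intro has_integral_add has_integral_diff has_integral_mult_right 1 2 3)
  have 6: "bump r x ^ 3 * (euler x * lap x + (G x \<bullet> H x x + H x x \<bullet> G x) / 2 - G x \<bullet> G x)
        - (1/2) * (bump r x ^ 3 * (G x \<bullet> H x x + H x x \<bullet> G x)) + bump r x ^ 3 * (G x \<bullet> G x) = bump r x ^ 3 * (euler x * lap x)" for x
    by (simp add: algebra_simps add_divide_distrib)
  have 7: "3 - 1 = (2::nat)" by simp
  show ?thesis using 5 unfolding 6 7 4 by (simp add: algebra_simps)
qed

text \<open>The Rellich-type identity expresses the derivative of the gradient part through
  \<open>euler\<close>. The mixed integrals of \<open>w x * euler x\<close> it produces, with
  coefficient 24, cancel against the derivative of \<open>12 * monneau\<close>, so that a square and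
  the Laplacian term remain.\<close>

lemma weiss_has_derivative:
  assumes r: "0 < r" "r < 1"
  shows "(weiss has_real_derivative
     (12 * bump_int 2 (\<lambda>x. euler x * euler x) r - 2 * integral UNIV (\<lambda>x. bump r x ^ 3 * (euler x * lap x)))
       / r ^ (DIM('a) + 9)) (at r)"
proof -
  have 1: "((\<lambda>r. bump_int 3 (\<lambda>x. G x \<bullet> G x) r / r ^ (DIM('a) + 8)) has_real_derivative
      (2 * real 3 * r\<^sup>2 * bump_int (3 - 1) (\<lambda>x. G x \<bullet> G x) r - real (DIM('a) + 8) * bump_int 3 (\<lambda>x. G x \<bullet> G x) r) / r ^ (DIM('a) + 8 + 1)) (at r)"
    by (intro bump_int_scaled_has_derivative blips r) auto
  have 2: "weiss = (\<lambda>r. bump_int 3 (\<lambda>x. G x \<bullet> G x) r / r ^ (DIM('a) + 8) - 12 * monneau r)"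
    by (simp add: weiss_def monneau_def diff_divide_distrib fun_eq_iff)
  have 3: "weiss r / (3 * r) + integral UNIV (\<lambda>x. bump r x ^ 3 * (w x * lap x)) / (3 * r ^ (DIM('a) + 9))
     = 2 * bump_int 2 (\<lambda>x. w x * euler x) r / r ^ (DIM('a) + 9)"
    using r unfolding integral_unique[OF has_integral_w_lap[OF r]] weiss_def
    by (simp add: field_simps power_add eval_nat_numeral)
  have 4: "12 * bump_int 2 (\<lambda>x. euler x * euler x) r - 2 * integral UNIV (\<lambda>x. bump r x ^ 3 * (euler x * lap x))
      = 6 * r\<^sup>2 * bump_int 2 (\<lambda>x. G x \<bullet> G x) r - real (DIM('a) + 8) * bump_int 3 (\<lambda>x. G x \<bullet> G x) r
        - 12 * (2 * bump_int 2 (\<lambda>x. w x * euler x) r)"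
    unfolding integral_unique[OF has_integral_euler_lap[OF r]] by (simp add: algebra_simps)
  show ?thesis
    unfolding 2 4
    by (rule DERIV_cong[OF DERIV_diff[OF 1 DERIV_cmult[OF monneau_has_derivative[OF r], of 12]]], unfold 3)
       (simp add: diff_divide_distrib add.commute[of 9])
qed

lemma weiss_mono:
  assumes sign: "\<And>x. x \<in> ball 0 1 \<Longrightarrow> x \<notin> N \<Longrightarrow> euler x * lap x \<le> 0"
    and r: "0 < r" "r \<le> s" "s < 1"
  shows "weiss r \<le> weiss s"
proof (rule DERIV_nonneg_imp_nondecreasing[OF \<open>r \<le> s\<close>])
  fix t assume "r \<le> t" "t \<le> s"
  then have t: "0 < t" "t < 1" using r by auto
  have "((\<lambda>x. bump t x ^ 3 * (- (euler x * lap x))) has_integral - integral UNIV (\<lambda>x. bump t x ^ 3 * (euler x * lap x))) UNIV"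
    using has_integral_neg[OF integrable_integral[OF has_integral_integrable[OF has_integral_euler_lap[OF t]]]] by simp
  then have "0 \<le> - integral UNIV (\<lambda>x. bump t x ^ 3 * (euler x * lap x))"
    by (rule bump_int_nonneg_ae[OF _ t _ N]) (use sign in auto)
  moreover have "0 \<le> bump_int 2 (\<lambda>x. euler x * euler x) t"
    by (rule bump_int_nonneg_ae[OF bump_int_has_integral[OF _ t] t _ N]) (auto intro!: blips)
  ultimately have "0 \<le> (12 * bump_int 2 (\<lambda>x. euler x * euler x) t
      - 2 * integral UNIV (\<lambda>x. bump t x ^ 3 * (euler x * lap x))) / t ^ (DIM('a) + 9)"
    using t by simp
  then show "\<exists>y. (weiss has_real_derivative y) (at t) \<and> 0 \<le> y"
    using weiss_has_derivative[OF t] by blast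
qed

end

section \<open>Size estimates and limits as the radius tends to zero\<close>

lemma has_integral_const_cball:
  fixes z :: "'a::euclidean_space"
  assumes "r \<ge> 0"
  shows "((\<lambda>x. if x \<in> cball z r then c else 0) has_integral unit_ball_vol (real DIM('a)) * r ^ DIM('a) * c) UNIV"
proof -
  have "measure lebesgue (cball z r) = unit_ball_vol (real DIM('a)) * r ^ DIM('a)"
    using content_cball[OF assms, of z] by (simp add: measure_completion)
  then have "((\<lambda>x. 1) has_integral unit_ball_vol (real DIM('a)) * r ^ DIM('a)) (cball z r)"
    using lmeasurable_iff_has_integral[of "cball z r"] lmeasurable_cball[of z r]
    by (metis lmeasurable_iff_integrable_on integrable_integral lmeasure_integral)
  from has_integral_mult_left[OF this, of c] show ?thesis
    unfolding has_integral_restrict_UNIV by simp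
qed

lemma bump_int_abs_le:
  fixes f :: "'a::euclidean_space \<Rightarrow> real"
  assumes f: "blip_on (ball 0 1) f" and r: "0 < r" "r < 1" and k: "k \<ge> 1"
    and c: "\<And>x. norm x \<le> r \<Longrightarrow> \<bar>f x\<bar> \<le> c"
  shows "\<bar>bump_int k f r\<bar> \<le> c * (r ^ (2 * k) * (unit_ball_vol (real DIM('a)) * r ^ DIM('a)))"
proof -
  have cst: "((\<lambda>x. if x \<in> cball (0::'a) r then r ^ (2 * k) * c else 0) has_integral
      unit_ball_vol (real DIM('a)) * r ^ DIM('a) * (r ^ (2 * k) * c)) UNIV"
    using r by (intro has_integral_const_cball) auto
  have "norm (integral UNIV (\<lambda>x. bump r x ^ k * f x)) \<le> integral UNIV (\<lambda>x. if x \<in> cball (0::'a) r then r ^ (2 * k) * c else 0)"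
  proof (rule integral_norm_bound_integral)
    show "(\<lambda>x. bump r x ^ k * f x) integrable_on UNIV" by (rule bump_integrable) (use f r k in auto)
    show "(\<lambda>x. if x \<in> cball (0::'a) r then r ^ (2 * k) * c else 0) integrable_on UNIV"
      using cst by blast
    fix x :: 'a
    show "norm (bump r x ^ k * f x) \<le> (if x \<in> cball 0 r then r ^ (2 * k) * c else 0)"
    proof (cases "norm x \<le> r")
      case True
      have "bump r x ^ k \<le> (r\<^sup>2) ^ k" by (intro power_mono bump_le) simp
      then show ?thesis
        using True c[OF True] r by (auto simp: abs_mult power_mult intro!: mult_mono)
    next
      case False
      then show ?thesis using r k bump_outside[of r x] by (simp add: power_0_left)
    qed
  qed
  also have "\<dots> = unit_ball_vol (real DIM('a)) * r ^ DIM('a) * (r ^ (2 * k) * c)" using cst by (rule integral_unique)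
  finally show ?thesis by (simp add: bump_int_def mult_ac)
qed

lemma mono_bounded_tendsto_at_right:
  fixes f :: "real \<Rightarrow> real"
  assumes mono: "\<And>r s. 0 < r \<Longrightarrow> r \<le> s \<Longrightarrow> s < 1 \<Longrightarrow> f r \<le> f s"
    and lower: "\<And>r. 0 < r \<Longrightarrow> r < 1 \<Longrightarrow> c \<le> f r"
  shows "\<exists>l. (f \<longlongrightarrow> l) (at_right 0)"
proof -
  define l where "l = Inf (f ` {0<..<1})"
  have bdd: "bdd_below (f ` {0<..<1})" using lower by (intro bdd_belowI[of _ c]) auto
  have "(f \<longlongrightarrow> l) (at_right 0)"
  proof (rule decreasing_tendsto)
    have "l \<le> f r" if "r \<in> {0<..<1}" for r unfolding l_def using that bdd by (intro cInf_lower) auto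
    then show "\<forall>\<^sub>F r in at_right 0. l \<le> f r"
      by (intro eventually_at_rightI[of 0 1]) auto
  next
    fix x assume "l < x"
    moreover have "f ` {0<..<1} \<noteq> {}" by simp
    ultimately obtain s where s: "s \<in> {0<..<1}" "f s < x"
      unfolding l_def using bdd cInf_less_iff[of "f ` {0<..<1}" x] by auto
    have "f r < x" if "r \<in> {0<..<s}" for r
      using mono[of r s] s that by auto
    then show "\<forall>\<^sub>F r in at_right 0. f r < x"
      using s by (intro eventually_at_rightI[of 0 s]) auto
  qed
  then show ?thesis ..
qed

context gradient_lipschitz
begin

lemma monneau_nonneg:
  assumes "0 < r" "r < 1"
  shows "0 \<le> monneau r"
proof -
  have "0 \<le> bump_int 2 (\<lambda>x. w x * w x) r"
    by (rule bump_int_nonneg_ae[OF bump_int_has_integral[OF _ assms] assms _ N]) (auto intro!: blips)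
  then show ?thesis using assms by (simp add: monneau_def)
qed

lemma monneau_le:
  assumes r: "0 < r" "r < 1" and small: "\<And>x. norm x \<le> r \<Longrightarrow> \<bar>w x\<bar> \<le> e * r\<^sup>2"
  shows "monneau r \<le> e\<^sup>2 * unit_ball_vol (real DIM('a))"
proof -
  have "\<bar>w x * w x\<bar> \<le> (e * r\<^sup>2)\<^sup>2" if "norm x \<le> r" for x
    using power_mono[OF small[OF that], of 2] by (simp add: power2_eq_square)
  then have "\<bar>bump_int 2 (\<lambda>x. w x * w x) r\<bar> \<le> (e * r\<^sup>2)\<^sup>2 * (r ^ (2 * 2) * (unit_ball_vol (real DIM('a)) * r ^ DIM('a)))"
    by (intro bump_int_abs_le blips r) auto
  then show ?thesis
    using r by (simp add: monneau_def field_simps power_add power_mult_distrib)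
qed

text \<open>If \<open>\<bar>w x\<bar> > d * (norm x)\<^sup>2\<close>, then the Lipschitz bound keeps \<open>w\<close> large on a ball around \<open>x\<close> of radius
  proportional to \<open>norm x\<close>, which contributes a fixed amount to \<open>monneau (2 * norm x)\<close>.\<close>

lemma w_small:
  assumes w0: "w 0 = 0" and G0: "G 0 = 0" and L: "L > 0" and lim: "(monneau \<longlongrightarrow> 0) (at_right 0)" and d: "d > 0"
  shows "\<exists>s>0. \<forall>x. norm x < s \<longrightarrow> \<bar>w x\<bar> \<le> d * (norm x)\<^sup>2"
proof -
  \<comment> \<open>The bound \<open>1/2\<close> keeps the ball around \<open>x\<close> within norm
    \<open>3/2 * a\<close>, where \<open>w\<close> has Lipschitz constant
    \<open>L * (3/2 * a)\<close>. The bound \<open>d / (3 * L)\<close> then limits the variation of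
    \<open>w\<close> on it to \<open>d * a\<^sup>2 / 2\<close>.\<close>
  define \<theta> where "\<theta> = min (1/2) (d / (3 * L))"
  have \<theta>: "0 < \<theta>" "\<theta> \<le> 1/2" "3 * L * \<theta> \<le> d" using L d by (auto simp: \<theta>_def min_def field_simps)
  define V where "V = unit_ball_vol (real DIM('a))"
  have "V > 0" by (simp add: V_def)
  \<comment> \<open>The lower bound for \<open>monneau (2 * a)\<close>: volume
    \<open>V * (\<theta> * a) ^ DIM('a)\<close>, weight at least \<open>(a\<^sup>2)\<^sup>2\<close>,
    square of \<open>w\<close> at least \<open>(d * a\<^sup>2 / 2)\<^sup>2\<close>, divided by
    \<open>(2 * a) ^ (DIM('a) + 8)\<close>. All powers of \<open>a\<close> cancel.\<close>
  define c where "c = d\<^sup>2 * (\<theta> ^ DIM('a) * V) / (4 * 2 ^ (DIM('a) + 8))"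
  have "c > 0" using d \<theta> \<open>V > 0\<close> by (simp add: c_def)
  then have "\<forall>\<^sub>F r in at_right 0. monneau r < c" using order_tendstoD(2)[OF lim] by blast
  then obtain b where b: "b > 0" "\<And>r. 0 < r \<Longrightarrow> r < b \<Longrightarrow> monneau r < c"
    unfolding eventually_at_right_field by auto
  have "\<bar>w x\<bar> \<le> d * (norm x)\<^sup>2" if x: "norm x < min (1/2) (b / 2)" for x
  proof (cases "x = 0")
    case True
    then show ?thesis using w0 by simp
  next
    case False
    define a where "a = norm x"
    have a: "0 < a" "2 * a < 1" "2 * a < b" using False x by (auto simp: a_def)
    show ?thesis
    proof (rule ccontr)
      assume "\<not> ?thesis"
      then have big: "\<bar>w x\<bar> > d * a\<^sup>2" by (simp add: a_def)
      have near: "norm y \<le> 3/2 * a" if "y \<in> cball x (\<theta> * a)" for y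
      proof -
        have "norm y \<le> norm x + norm (y - x)" by (metis add.commute diff_add_cancel norm_triangle_ineq)
        also have "norm (y - x) \<le> \<theta> * a" using that by (simp add: dist_norm norm_minus_commute)
        also have "\<theta> * a \<le> 1/2 * a" using \<theta> a by (intro mult_right_mono) auto
        finally show ?thesis by (simp add: a_def)
      qed
      have large: "\<bar>w y\<bar> \<ge> d * a\<^sup>2 / 2" if y: "y \<in> cball x (\<theta> * a)" for y
      proof -
        have "norm (w y - w x) \<le> (L * (3/2 * a)) * norm (y - x)"
        proof (rule differentiable_bound[where S = "cball x (\<theta> * a)" and f' = "\<lambda>x h. G x \<bullet> h"])
          fix z assume z: "z \<in> cball x (\<theta> * a)"
          then have z1: "z \<in> ball 0 1" using near[OF z] a by simp
          show "(w has_derivative (\<lambda>h. G z \<bullet> h)) (at z within cball x (\<theta> * a))"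
            using w_der[OF z1] by (rule has_derivative_at_withinI)
          have "norm (G z) \<le> L * norm z" using G_lip[OF z1, of 0] G0 by simp
          also have "\<dots> \<le> L * (3/2 * a)" using near[OF z] L by simp
          finally have "norm (G z) * norm h \<le> (L * (3/2 * a)) * norm h" for h :: 'a
            by (rule mult_right_mono) simp
          then have "\<bar>G z \<bullet> h\<bar> \<le> (L * (3/2 * a)) * norm h" for h
            using Cauchy_Schwarz_ineq2[of "G z" h] by (rule order_trans[rotated])
          then show "onorm (\<lambda>h. G z \<bullet> h) \<le> L * (3/2 * a)"
            by (intro onorm_le) simp
        qed (use y \<theta> a in auto)
        also have "\<dots> \<le> (L * (3/2 * a)) * (\<theta> * a)"
          using y L a by (intro mult_left_mono) (auto simp: dist_norm norm_minus_commute)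
        also have "\<dots> = (3 * L * \<theta>) * (a\<^sup>2 / 2)" by (simp add: power2_eq_square)
        also have "\<dots> \<le> d * (a\<^sup>2 / 2)" using \<theta> by (intro mult_right_mono) auto
        finally show ?thesis using big unfolding real_norm_def by linarith
      qed
      let ?m = "(a\<^sup>2)\<^sup>2 * (d * a\<^sup>2 / 2)\<^sup>2"
      have int: "((\<lambda>y. bump (2 * a) y ^ 2 * (w y * w y)) has_integral bump_int 2 (\<lambda>x. w x * w x) (2 * a)) UNIV"
        using a by (intro bump_int_has_integral blips) auto
      have cst: "((\<lambda>y. if y \<in> cball x (\<theta> * a) then ?m else 0) has_integral V * (\<theta> * a) ^ DIM('a) * ?m) UNIV"
        unfolding V_def using \<theta> a by (intro has_integral_const_cball) auto
      have "V * (\<theta> * a) ^ DIM('a) * ?m \<le> bump_int 2 (\<lambda>x. w x * w x) (2 * a)"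
      proof (rule has_integral_le[OF cst int])
        fix y :: 'a
        show "(if y \<in> cball x (\<theta> * a) then ?m else 0) \<le> bump (2 * a) y ^ 2 * (w y * w y)"
        proof (cases "y \<in> cball x (\<theta> * a)")
          case True
          have "(norm y)\<^sup>2 \<le> (3/2 * a)\<^sup>2" using near[OF True] by (intro power_mono) auto
          then have "a\<^sup>2 \<le> bump (2 * a) y" by (simp add: bump_def power2_eq_square)
          then have "(a\<^sup>2)\<^sup>2 \<le> bump (2 * a) y ^ 2" by (intro power_mono) auto
          moreover have "(d * a\<^sup>2 / 2)\<^sup>2 \<le> \<bar>w y\<bar>\<^sup>2" using large[OF True] d by (intro power_mono) auto
          ultimately have "?m \<le> bump (2 * a) y ^ 2 * \<bar>w y\<bar>\<^sup>2" by (intro mult_mono) auto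
          then show ?thesis using True by (simp add: power2_eq_square)
        qed auto
      qed
      then have "c \<le> monneau (2 * a)"
        using a by (simp add: c_def monneau_def field_simps power_mult_distrib power_add eval_nat_numeral)
      then show False using b(2)[of "2 * a"] a by simp
    qed
  qed
  then show ?thesis using b by (intro exI[of _ "min (1/2) (b / 2)"]) auto
qed

text \<open>Interpolation between values and second derivatives: a step of length proportional to
  \<open>norm x\<close> along the gradient changes \<open>w\<close> to first order by that length
  times \<open>norm (G x)\<close>, up to a second-order error governed by \<open>L\<close>, while
  \<open>w\<close> is small at both ends.\<close>

lemma G_small:
  assumes G0: "G 0 = 0" and L: "L > 0" and d: "d > 0"
    and small: "\<And>e. e > 0 \<Longrightarrow> \<exists>s>0. \<forall>x. norm x < s \<longrightarrow> \<bar>w x\<bar> \<le> e * (norm x)\<^sup>2"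
  shows "\<exists>s>0. \<forall>x. norm x < s \<longrightarrow> norm (G x) \<le> d * norm x"
proof -
  define \<theta> where "\<theta> = min 1 (d / (2 * L))"
  have \<theta>: "0 < \<theta>" "\<theta> \<le> 1" "L * \<theta> \<le> d / 2" using L d by (auto simp: \<theta>_def min_def field_simps)
  \<comment> \<open>Since \<open>norm y \<le> 2 * a\<close>, the two values of \<open>w\<close> cost
    \<open>4 + 1 = 5\<close> units of \<open>d * \<theta> / 10 * a\<^sup>2\<close>, which is half of
    the budget; the other half pays for the second-order error through
    \<open>L * \<theta> \<le> d / 2\<close>.\<close>
  obtain s where s: "s > 0" "\<And>x. norm x < s \<Longrightarrow> \<bar>w x\<bar> \<le> (d * \<theta> / 10) * (norm x)\<^sup>2"
    using small[of "d * \<theta> / 10"] d \<theta> by auto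
  have "norm (G x) \<le> d * norm x" if x: "norm x < min s 1 / 2" for x
  proof (cases "G x = 0 \<or> x = 0")
    case True
    then show ?thesis using G0 d by auto
  next
    case False
    define a where "a = norm x"
    have a: "0 < a" "2 * a < s" "2 * a < 1" using False x by (auto simp: a_def)
    define y where "y = x + (\<theta> * a) *\<^sub>R sgn (G x)"
    have yx: "norm (y - x) = \<theta> * a" using False \<theta> a by (simp add: y_def norm_sgn)
    have "G x \<bullet> sgn (G x) = norm (G x)"
      using False by (simp add: sgn_div_norm power2_norm_eq_inner[symmetric] power2_eq_square)
    then have Gy: "G x \<bullet> (y - x) = \<theta> * a * norm (G x)" by (simp add: y_def)
    have in_ball: "norm z \<le> 2 * a" if "z \<in> cball x (\<theta> * a)" for z
    proof -
      have "norm z \<le> norm x + norm (z - x)" by (metis add.commute diff_add_cancel norm_triangle_ineq)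
      also have "norm (z - x) \<le> \<theta> * a" using that by (simp add: dist_norm norm_minus_commute)
      also have "\<theta> * a \<le> 1 * a" using \<theta> a by (intro mult_right_mono) auto
      finally show ?thesis by (simp add: a_def)
    qed
    have "norm ((w y - G x \<bullet> y) - (w x - G x \<bullet> x)) \<le> (L * (\<theta> * a)) * norm (y - x)"
    proof (rule differentiable_bound[where S = "cball x (\<theta> * a)" and f' = "\<lambda>z h. G z \<bullet> h - G x \<bullet> h"])
      fix z assume z: "z \<in> cball x (\<theta> * a)"
      then have z1: "z \<in> ball 0 1" using in_ball[OF z] a by simp
      have x1: "x \<in> ball 0 1" using a by (simp add: a_def)
      show "((\<lambda>z. w z - G x \<bullet> z) has_derivative (\<lambda>h. G z \<bullet> h - G x \<bullet> h)) (at z within cball x (\<theta> * a))"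
        by (rule has_derivative_at_withinI) (auto intro!: derivative_eq_intros w_der[OF z1])
      have "norm (G z - G x) \<le> L * norm (z - x)" by (rule G_lip[OF z1 x1])
      also have "\<dots> \<le> L * (\<theta> * a)" using z L by (simp add: dist_norm norm_minus_commute)
      finally have "norm (G z - G x) * norm h \<le> (L * (\<theta> * a)) * norm h" for h :: 'a
        by (rule mult_right_mono) simp
      then have "\<bar>(G z - G x) \<bullet> h\<bar> \<le> (L * (\<theta> * a)) * norm h" for h
        using Cauchy_Schwarz_ineq2[of "G z - G x" h] by (rule order_trans[rotated])
      then show "onorm (\<lambda>h. G z \<bullet> h - G x \<bullet> h) \<le> L * (\<theta> * a)"
        by (intro onorm_le) (simp add: inner_diff_left)
    qed (use yx \<theta> a in \<open>auto simp: dist_norm norm_minus_commute\<close>)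
    then have "\<theta> * a * norm (G x) \<le> \<bar>w y\<bar> + \<bar>w x\<bar> + (L * (\<theta> * a)) * (\<theta> * a)"
      using Gy yx by (simp add: inner_diff_right)
    also have "\<bar>w y\<bar> \<le> (d * \<theta> / 10) * (2 * a)\<^sup>2"
    proof -
      have "norm y \<le> 2 * a" using in_ball[of y] yx by (simp add: dist_norm norm_minus_commute)
      then have "\<bar>w y\<bar> \<le> (d * \<theta> / 10) * (norm y)\<^sup>2" "(norm y)\<^sup>2 \<le> (2 * a)\<^sup>2"
        using s(2)[of y] a power_mono[of "norm y" "2 * a" 2] by simp_all
      then show ?thesis using d \<theta> by (meson mult_left_mono order_trans divide_nonneg_pos mult_nonneg_nonneg less_imp_le zero_less_numeral)
    qed
    also have "\<bar>w x\<bar> \<le> (d * \<theta> / 10) * a\<^sup>2"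
    proof -
      have "norm x < s" using a unfolding a_def by linarith
      then show ?thesis using s(2)[of x] by (simp add: a_def)
    qed
    also have "(d * \<theta> / 10) * (2 * a)\<^sup>2 + (d * \<theta> / 10) * a\<^sup>2 + (L * (\<theta> * a)) * (\<theta> * a)
        = (\<theta> * a) * ((d / 2 + L * \<theta>) * a)"
      by (simp add: algebra_simps power2_eq_square)
    finally have "norm (G x) \<le> (d / 2 + L * \<theta>) * a" using \<theta> a by simp
    also have "\<dots> \<le> d * a" using \<theta> a by (intro mult_right_mono) auto
    finally show ?thesis by (simp add: a_def)
  qed
  then show ?thesis using s by (intro exI[of _ "min s 1 / 2"]) auto
qed

end

section \<open>Application to the superconductivity problem\<close>

lemma has_derivative_grad:
  fixes u :: "real^'n \<Rightarrow> real"
  assumes "u differentiable (at x)"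
  shows "(u has_derivative (\<lambda>h. grad u x \<bullet> h)) (at x)"
proof -
  let ?D = "frechet_derivative u (at x)"
  have D: "(u has_derivative ?D) (at x)" using assms frechet_derivative_works by blast
  then interpret bounded_linear ?D by (rule has_derivative_bounded_linear)
  have "?D h = grad u x \<bullet> h" for h
  proof -
    have "?D h = ?D (\<Sum>i\<in>UNIV. h $ i *\<^sub>R axis i 1)" by (metis basis_expansion scalar_mult_eq_scaleR)
    also have "\<dots> = grad u x \<bullet> h" by (simp add: sum scaleR grad_def inner_vec_def mult.commute)
    finally show ?thesis .
  qed
  then have "?D = (\<lambda>h. grad u x \<bullet> h)" by auto
  with D show ?thesis by simp
qed

lemma grad_eqI:
  fixes u :: "real^'n \<Rightarrow> real"
  assumes "(u has_derivative (\<lambda>h. g \<bullet> h)) (at x)"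
  shows "grad u x = g"
  unfolding grad_def frechet_derivative_at[OF assms, symmetric] by (simp add: vec_eq_iff inner_axis)

lemma symmetric_matrix_inner:
  fixes A :: "real^'n^'n"
  assumes "transpose A = A"
  shows "x \<bullet> (A *v y) = (A *v x) \<bullet> y"
  using dot_lmul_matrix[of x A y] transpose_matrix_vector[of A x] assms by simp

lemma has_derivative_quadratic:
  fixes A :: "real^'n^'n"
  assumes "transpose A = A"
  shows "((\<lambda>x. (1/2) * (x \<bullet> (A *v x))) has_derivative (\<lambda>h. (A *v x) \<bullet> h)) (at x)"
proof -
  have "((\<lambda>x. A *v x) has_derivative (\<lambda>h. A *v h)) (at x)"
    by (intro bounded_linear_imp_has_derivative matrix_vector_mul_bounded_linear)
  from has_derivative_mult_right[OF has_derivative_inner[OF has_derivative_ident this], of "1/2"]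
  show ?thesis
    by (rule has_derivative_eq_rhs) (simp add: symmetric_matrix_inner[OF assms, of x] inner_commute[of _ "A *v x"])
qed

lemma norm_matrix_vector_mul_le:
  fixes A :: "real^'n^'m"
  shows "norm (A *v x) \<le> onorm ((*v) A) * norm x"
  by (rule onorm[OF matrix_vector_mul_bounded_linear])

lemma onorm_matrix_nonneg: "0 \<le> onorm ((*v) (A :: real^'n^'m))"
  by (rule onorm_pos_le[OF matrix_vector_mul_bounded_linear])

lemma abs_quadratic_le:
  fixes A :: "real^'n^'n"
  shows "\<bar>(1/2) * (x \<bullet> (A *v x))\<bar> \<le> onorm ((*v) A) / 2 * (norm x)\<^sup>2"
proof -
  have "\<bar>x \<bullet> (A *v x)\<bar> \<le> norm x * norm (A *v x)" by (rule Cauchy_Schwarz_ineq2)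
  also have "\<dots> \<le> norm x * (onorm ((*v) A) * norm x)"
    by (intro mult_left_mono norm_matrix_vector_mul_le) simp
  finally show ?thesis by (simp add: power2_eq_square algebra_simps abs_mult)
qed

lemma trace_matrix_Basis:
  fixes f :: "real^'n \<Rightarrow> real^'n"
  shows "trace (matrix f) = (\<Sum>b\<in>Basis. f b \<bullet> b)"
proof -
  have B: "(Basis :: (real^'n) set) = (\<lambda>i. axis i 1) ` UNIV" by (auto simp: Basis_vec_def)
  have "(\<Sum>b\<in>Basis. f b \<bullet> b) = (\<Sum>i\<in>UNIV. f (axis i 1) \<bullet> axis i 1)"
    unfolding B by (subst sum.reindex) (auto simp: inj_on_def axis_eq_axis)
  then show ?thesis by (simp add: trace_def matrix_def inner_axis)
qed

lemma gradient_lipschitz_quadratic: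
  fixes A :: "real^'n^'n"
  assumes "transpose A = A"
  shows "gradient_lipschitz (\<lambda>x. (1/2) * (x \<bullet> (A *v x))) (\<lambda>x. A *v x) (\<lambda>x h. A *v h) {} (onorm ((*v) A))"
proof
  fix x y :: "real^'n"
  show "((\<lambda>x. (1/2) * (x \<bullet> (A *v x))) has_derivative (\<lambda>h. (A *v x) \<bullet> h)) (at x)"
    by (rule has_derivative_quadratic[OF assms])
  show "norm (A *v x - A *v y) \<le> onorm ((*v) A) * norm (x - y)"
    using norm_matrix_vector_mul_le[of A "x - y"] by (simp add: matrix_vector_mult_diff_distrib)
  show "((*v) A has_derivative (*v) A) (at x)"
    by (intro bounded_linear_imp_has_derivative matrix_vector_mul_bounded_linear)
qed auto

text \<open>Trace zero makes the form harmonic and homogeneity makes \<open>euler\<close> vanish, so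
  \<open>has_integral_w_lap\<close> reduces to its bracket. This allows one quadratic to be
  exchanged for another in the Weiss functional.\<close>

lemma weiss_harmonic_quadratic:
  fixes A :: "real^'n^'n"
  assumes "transpose A = A" "trace A = 0" and r: "0 < r" "r < 1"
  shows "bump_int 3 (\<lambda>x. (A *v x) \<bullet> (A *v x)) r
      = 12 * bump_int 2 (\<lambda>x. ((1/2) * (x \<bullet> (A *v x))) * ((1/2) * (x \<bullet> (A *v x)))) r"
proof -
  interpret gradient_lipschitz "\<lambda>x. (1/2) * (x \<bullet> (A *v x))" "\<lambda>x. A *v x" "\<lambda>x h. A *v h" "{}" "onorm ((*v) A)"
    by (rule gradient_lipschitz_quadratic[OF assms(1)])
  have "lap = (\<lambda>x. 0)" "euler = (\<lambda>x. 0)"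
    unfolding fun_eq_iff lap_def euler_def using trace_matrix_Basis[of "(*v) A"] assms(2) by simp_all
  then have "((\<lambda>x::real^'n. 0::real) has_integral - (bump_int 3 (\<lambda>x. (A *v x) \<bullet> (A *v x)) r
      - 12 * bump_int 2 (\<lambda>x. ((1/2) * (x \<bullet> (A *v x))) * ((1/2) * (x \<bullet> (A *v x)))) r)) UNIV"
    using has_integral_w_lap[OF r] by (simp add: bump_int_def)
  then show ?thesis using has_integral_unique[OF _ has_integral_0] by force
qed

section \<open>The solution minus a quadratic\<close>

text \<open>The almost-everywhere equation is fixed to one null set \<open>N\<close>, shared by all
  matrices, so that integrands belonging to different quadratics can be added pointwise.\<close>

locale superconductor =
  fixes u :: "real^'n \<Rightarrow> real" and M :: real and N :: "(real^'n) set"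
  assumes M: "M > 0"
    and u_diff: "\<And>x. x \<in> ball 0 1 \<Longrightarrow> u differentiable (at x)"
    and grad_lip: "\<And>x y. x \<in> ball 0 1 \<Longrightarrow> y \<in> ball 0 1 \<Longrightarrow> norm (grad u x - grad u y) \<le> M * norm (x - y)"
    and null: "negligible N"
    and grad_diff: "\<And>x. x \<in> ball 0 1 \<Longrightarrow> x \<notin> N \<Longrightarrow> grad u differentiable (at x)"
    and laplacian: "\<And>x. x \<in> ball 0 1 \<Longrightarrow> x \<notin> N \<Longrightarrow> laplacian u x = (if grad u x \<noteq> 0 then 1 else 0)"
    and flat_le: "\<And>x. x \<in> ball 0 1 \<Longrightarrow> grad u x = 0 \<Longrightarrow> u x \<le> u 0"
begin

definition W :: "real^'n^'n \<Rightarrow> real^'n \<Rightarrow> real" where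
  "W A x = u x - u 0 - (1/2) * (x \<bullet> (A *v x))"

definition GW :: "real^'n^'n \<Rightarrow> real^'n \<Rightarrow> real^'n" where
  "GW A x = grad u x - A *v x"

definition HW :: "real^'n^'n \<Rightarrow> real^'n \<Rightarrow> real^'n \<Rightarrow> real^'n" where
  "HW A x h = frechet_derivative (grad u) (at x) h - A *v h"

abbreviation weissW :: "real^'n^'n \<Rightarrow> real \<Rightarrow> real" where
  "weissW A \<equiv> gradient_lipschitz.weiss (W A) (GW A)"

abbreviation monneauW :: "real^'n^'n \<Rightarrow> real \<Rightarrow> real" where
  "monneauW A \<equiv> gradient_lipschitz.monneau (W A)"

abbreviation lapW :: "real^'n^'n \<Rightarrow> real^'n \<Rightarrow> real" where
  "lapW A \<equiv> gradient_lipschitz.lap (HW A)"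

lemma gradient_lipschitz_W:
  assumes "transpose A = A"
  shows "gradient_lipschitz (W A) (GW A) (HW A) N (M + onorm ((*v) A))"
proof
  fix x y :: "real^'n" assume x: "x \<in> ball 0 1"
  show "(W A has_derivative (\<lambda>h. GW A x \<bullet> h)) (at x)"
    unfolding W_def[abs_def] GW_def inner_diff_left
    using has_derivative_diff[OF has_derivative_diff[OF has_derivative_grad[OF u_diff[OF x]] has_derivative_const]
        has_derivative_quadratic[OF assms]] by simp
  show "(GW A has_derivative HW A x) (at x)" if "x \<notin> N"
    unfolding GW_def[abs_def] HW_def[abs_def]
    using grad_diff[OF x that] frechet_derivative_works
    by (intro has_derivative_diff bounded_linear_imp_has_derivative matrix_vector_mul_bounded_linear) blast
  assume y: "y \<in> ball 0 1"
  have "norm (GW A x - GW A y) \<le> norm (grad u x - grad u y) + norm (A *v x - A *v y)"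
    unfolding GW_def using norm_triangle_ineq4[of "grad u x - grad u y" "A *v x - A *v y"] by (simp add: algebra_simps)
  also have "norm (A *v x - A *v y) \<le> onorm ((*v) A) * norm (x - y)"
    using norm_matrix_vector_mul_le[of A "x - y"] by (simp add: matrix_vector_mult_diff_distrib)
  finally show "norm (GW A x - GW A y) \<le> (M + onorm ((*v) A)) * norm (x - y)"
    using grad_lip[OF x y] by (simp add: algebra_simps)
qed (rule null)

text \<open>Subtracting trace one turns the values 1 and 0 of the Laplacian into 0 and -1. The
  result does not depend on \<open>A\<close>, which is what makes sums over several quadratics
  tractable.\<close>

lemma lapW:
  assumes A: "transpose A = A" "trace A = 1" and x: "x \<in> ball 0 1" "x \<notin> N"
  shows "lapW A x = (if grad u x = 0 then -1 else 0)"
proof -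
  interpret gradient_lipschitz "W A" "GW A" "HW A" N "M + onorm ((*v) A)"
    by (rule gradient_lipschitz_W[OF A(1)])
  have "lapW A x = (\<Sum>b\<in>Basis. frechet_derivative (grad u) (at x) b \<bullet> b) - (\<Sum>b\<in>Basis. (A *v b) \<bullet> b)"
    by (simp add: lap_def HW_def inner_diff_left sum_subtractf)
  also have "\<dots> = laplacian u x - trace A"
    by (simp add: laplacian_def jacobian_def flip: trace_matrix_Basis)
  finally show ?thesis using laplacian[OF x] A by simp
qed

lemma weissW_mono:
  assumes A: "transpose A = A" "trace A = 1" and r: "0 < r" "r \<le> s" "s < 1"
  shows "weissW A r \<le> weissW A s"
proof -
  interpret gradient_lipschitz "W A" "GW A" "HW A" N "M + onorm ((*v) A)"
    by (rule gradient_lipschitz_W[OF A(1)])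
  show ?thesis
  proof (rule weiss_mono[OF _ r])
    fix x :: "real^'n" assume x: "x \<in> ball 0 1" "x \<notin> N"
    \<comment> \<open>The quadratic has cancelled. On the flat set
      \<open>euler x = -2 * (u x - u 0)\<close> is non-negative by \<open>flat_le\<close> while
      \<open>lap x = -1\<close>; elsewhere \<open>lap x = 0\<close>.\<close>
    have "euler x = x \<bullet> grad u x - 2 * (u x - u 0)"
      by (simp add: euler_def W_def GW_def inner_diff_right)
    then show "euler x * lap x \<le> 0"
      using lapW[OF A x] flat_le[OF x(1)] by auto
  qed
qed

text \<open>\<open>W A\<close> is \<open>W B\<close> plus the form \<open>h\<close> of
  \<open>B - A\<close>, harmonic because the traces agree, so the pure \<open>h\<close> terms
  cancel. Every surviving term contains the small factor \<open>W B\<close> or \<open>GW B\<close>,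
  and \<open>e \<le> 1\<close> absorbs the squares into a bound linear in \<open>e\<close>.\<close>

lemma weissW_bound:
  assumes A: "transpose A = A" "trace A = 1" and B: "transpose B = B" "trace B = 1"
    and K: "K = onorm ((*v) (B - A))" and r: "0 < r" "r < 1" and e: "0 < e" "e \<le> 1"
    and w: "\<And>x. norm x \<le> r \<Longrightarrow> \<bar>W B x\<bar> \<le> e * r\<^sup>2"
    and g: "\<And>x. norm x \<le> r \<Longrightarrow> norm (GW B x) \<le> e * r"
  shows "\<bar>weissW A r\<bar> \<le> e * ((1 + 2 * K + 12 * (1 + K)) * unit_ball_vol (real CARD('n)))"
proof -
  interpret A: gradient_lipschitz "W A" "GW A" "HW A" N "M + onorm ((*v) A)"
    by (rule gradient_lipschitz_W[OF A(1)])
  let ?C = "B - A"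
  have C: "transpose ?C = ?C" "trace ?C = 0"
    using A B by (auto simp: transpose_def vec_eq_iff trace_sub)
  interpret C: gradient_lipschitz "\<lambda>x. (1/2) * (x \<bullet> (?C *v x))" "\<lambda>x. ?C *v x" "\<lambda>x h. ?C *v h" "{}" "onorm ((*v) ?C)"
    by (rule gradient_lipschitz_quadratic[OF C(1)])
  let ?V = "unit_ball_vol (real DIM(real^'n))"
  define h where "h x = (1/2) * (x \<bullet> (?C *v x))" for x
  note blip_h = C.blip_w[folded h_def]
  have "K \<ge> 0" unfolding K by (rule onorm_matrix_nonneg)
  have WA: "W A x = W B x + h x" and GA: "GW A x = GW B x + ?C *v x" for x
    by (simp_all add: W_def h_def GW_def matrix_vector_mult_diff_rdistrib inner_diff_right algebra_simps)
  have h_le: "\<bar>h x\<bar> \<le> K / 2 * r\<^sup>2" if "norm x \<le> r" for x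
  proof -
    have "\<bar>h x\<bar> \<le> K / 2 * (norm x)\<^sup>2" unfolding h_def K by (rule abs_quadratic_le)
    also have "\<dots> \<le> K / 2 * r\<^sup>2" using that \<open>K \<ge> 0\<close> by (intro mult_left_mono power_mono) auto
    finally show ?thesis .
  qed
  have C_le: "norm (?C *v x) \<le> K * r" if "norm x \<le> r" for x
  proof -
    have "norm (?C *v x) \<le> K * norm x" unfolding K by (rule norm_matrix_vector_mul_le)
    also have "\<dots> \<le> K * r" using that \<open>K \<ge> 0\<close> by (intro mult_left_mono) auto
    finally show ?thesis .
  qed
  have ee: "e * e \<le> e * 1" using e by (intro mult_left_mono) auto
  have f1: "\<bar>GW A x \<bullet> GW A x - (?C *v x) \<bullet> (?C *v x)\<bar> \<le> e * (1 + 2 * K) * r\<^sup>2" if x: "norm x \<le> r" for x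
  proof -
    have "GW A x \<bullet> GW A x - (?C *v x) \<bullet> (?C *v x) = GW B x \<bullet> (GW B x + 2 *\<^sub>R (?C *v x))"
      unfolding GA by (simp add: inner_add_left inner_add_right inner_commute)
    also have "\<bar>\<dots>\<bar> \<le> norm (GW B x) * norm (GW B x + 2 *\<^sub>R (?C *v x))" by (rule Cauchy_Schwarz_ineq2)
    also have "\<dots> \<le> (e * r) * (e * r + 2 * (K * r))"
    proof (rule mult_mono)
      show "norm (GW B x + 2 *\<^sub>R (?C *v x)) \<le> e * r + 2 * (K * r)"
        using norm_triangle_ineq[of "GW B x" "2 *\<^sub>R (?C *v x)"] g[OF x] C_le[OF x] by simp
    qed (use g[OF x] e r in auto)
    also have "\<dots> = (e * e + e * 2 * K) * r\<^sup>2" by (simp add: algebra_simps power2_eq_square)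
    also have "\<dots> \<le> (e * 1 + e * 2 * K) * r\<^sup>2" using ee by (intro mult_right_mono) auto
    finally show ?thesis by (simp add: algebra_simps)
  qed
  have f2: "\<bar>W A x * W A x - h x * h x\<bar> \<le> e * (1 + K) * r ^ 4" if x: "norm x \<le> r" for x
  proof -
    have "W A x * W A x - h x * h x = W B x * (W B x + 2 * h x)"
      unfolding WA by (simp add: algebra_simps)
    also have "\<bar>\<dots>\<bar> \<le> (e * r\<^sup>2) * (e * r\<^sup>2 + K * r\<^sup>2)"
      unfolding abs_mult
    proof (rule mult_mono)
      show "\<bar>W B x + 2 * h x\<bar> \<le> e * r\<^sup>2 + K * r\<^sup>2"
        using w[OF x] h_le[OF x] by linarith
    qed (use w[OF x] e r in auto)
    also have "\<dots> = (e * e + e * K) * r ^ 4" by (simp add: algebra_simps power_def numeral_eq_Suc)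
    also have "\<dots> \<le> (e * 1 + e * K) * r ^ 4" using ee r by (intro mult_right_mono) auto
    finally show ?thesis by (simp add: algebra_simps)
  qed
  have b1: "blip_on (ball 0 1) (\<lambda>x. GW A x \<bullet> GW A x - (?C *v x) \<bullet> (?C *v x))"
    by (intro blip_on_diff blip_on_inner A.blip_G C.blip_G)
  have b2: "blip_on (ball 0 1) (\<lambda>x. W A x * W A x - h x * h x)"
    by (intro blip_on_diff blip_on_mult A.blip_w blip_h)
  have "((\<lambda>x. bump r x ^ 3 * (GW A x \<bullet> GW A x) - bump r x ^ 3 * ((?C *v x) \<bullet> (?C *v x))) has_integral
     bump_int 3 (\<lambda>x. GW A x \<bullet> GW A x) r - bump_int 3 (\<lambda>x. (?C *v x) \<bullet> (?C *v x)) r) UNIV"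
    by (intro has_integral_diff bump_int_has_integral blip_on_inner A.blip_G C.blip_G r) auto
  then have d1: "bump_int 3 (\<lambda>x. GW A x \<bullet> GW A x) r - bump_int 3 (\<lambda>x. (?C *v x) \<bullet> (?C *v x)) r
     = bump_int 3 (\<lambda>x. GW A x \<bullet> GW A x - (?C *v x) \<bullet> (?C *v x)) r"
    by (subst (3) bump_int_def) (simp add: integral_unique right_diff_distrib)
  have "((\<lambda>x. bump r x ^ 2 * (W A x * W A x) - bump r x ^ 2 * (h x * h x)) has_integral
     bump_int 2 (\<lambda>x. W A x * W A x) r - bump_int 2 (\<lambda>x. h x * h x) r) UNIV"
    by (intro has_integral_diff bump_int_has_integral blip_on_mult A.blip_w blip_h r) auto
  then have d2: "bump_int 2 (\<lambda>x. W A x * W A x) r - bump_int 2 (\<lambda>x. h x * h x) r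
     = bump_int 2 (\<lambda>x. W A x * W A x - h x * h x) r"
    by (subst (3) bump_int_def) (simp add: integral_unique right_diff_distrib)
  have zero: "bump_int 3 (\<lambda>x. (?C *v x) \<bullet> (?C *v x)) r = 12 * bump_int 2 (\<lambda>x. h x * h x) r"
    unfolding h_def by (rule weiss_harmonic_quadratic[OF C r])
  have W: "weissW A r * r ^ (DIM(real^'n) + 8) =
      bump_int 3 (\<lambda>x. GW A x \<bullet> GW A x - (?C *v x) \<bullet> (?C *v x)) r - 12 * bump_int 2 (\<lambda>x. W A x * W A x - h x * h x) r"
    unfolding A.weiss_def d1[symmetric] d2[symmetric] zero using r by simp
  have j1: "\<bar>bump_int 3 (\<lambda>x. GW A x \<bullet> GW A x - (?C *v x) \<bullet> (?C *v x)) r\<bar>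
      \<le> e * (1 + 2 * K) * r\<^sup>2 * (r ^ (2 * 3) * (?V * r ^ DIM(real^'n)))"
    by (rule bump_int_abs_le[OF b1 r _ f1]) auto
  have j2: "\<bar>bump_int 2 (\<lambda>x. W A x * W A x - h x * h x) r\<bar>
      \<le> e * (1 + K) * r ^ 4 * (r ^ (2 * 2) * (?V * r ^ DIM(real^'n)))"
    by (rule bump_int_abs_le[OF b2 r _ f2]) auto
  have "\<bar>weissW A r\<bar> * r ^ (DIM(real^'n) + 8) = \<bar>weissW A r * r ^ (DIM(real^'n) + 8)\<bar>"
    using r by (simp add: abs_mult)
  also have "\<dots> \<le> e * (1 + 2 * K) * r\<^sup>2 * (r ^ (2 * 3) * (?V * r ^ DIM(real^'n)))
      + 12 * (e * (1 + K) * r ^ 4 * (r ^ (2 * 2) * (?V * r ^ DIM(real^'n))))"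
    unfolding W using j1 j2 by linarith
  also have "\<dots> = e * ((1 + 2 * K + 12 * (1 + K)) * ?V) * r ^ (DIM(real^'n) + 8)"
    by (simp add: algebra_simps power_add eval_nat_numeral)
  finally show ?thesis using r by simp
qed

end

section \<open>From the functionals to convergence of the rescalings\<close>

text \<open>Split \<open>D\<close> as \<open>D powr (1 - \<alpha>) * D powr \<alpha>\<close>, using
  smallness for the first factor and the Lipschitz bound for the second. The threshold solves
  \<open>\<tau> powr (1 - \<alpha>) * L powr \<alpha> = e\<close>.\<close>

lemma holder_interpolation:
  fixes \<alpha> :: real
  assumes \<alpha>: "0 < \<alpha>" "\<alpha> < 1" and L: "L > 0" and e: "e > 0"
  shows "\<exists>\<tau>>0. \<forall>D t. 0 \<le> D \<longrightarrow> 0 < t \<longrightarrow> D \<le> \<tau> \<longrightarrow> D \<le> L * t \<longrightarrow> D \<le> e * t powr \<alpha>"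
proof (intro exI conjI allI impI)
  define \<tau> where "\<tau> = (e / L powr \<alpha>) powr (1 / (1 - \<alpha>))"
  show "\<tau> > 0" using L e by (simp add: \<tau>_def)
  have \<tau>: "\<tau> powr (1 - \<alpha>) = e / L powr \<alpha>" using \<alpha> L e by (simp add: \<tau>_def powr_powr)
  fix D t :: real assume D: "0 \<le> D" "0 < t" "D \<le> \<tau>" "D \<le> L * t"
  have "D = D powr (1 - \<alpha>) * D powr \<alpha>"
    using D \<alpha> by (cases "D = 0") (auto simp flip: powr_add)
  also have "\<dots> \<le> \<tau> powr (1 - \<alpha>) * (L * t) powr \<alpha>"
    using D \<alpha> by (intro mult_mono powr_mono2) auto
  also have "\<dots> = e * t powr \<alpha>"
    using L D by (simp add: \<tau> powr_mult)
  finally show "D \<le> e * t powr \<alpha>" .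
qed

context superconductor
begin

lemma rescale_has_derivative:
  assumes "r > 0" "r *\<^sub>R x \<in> ball 0 1"
  shows "(rescale u 0 r has_derivative (\<lambda>h. (grad u (r *\<^sub>R x) /\<^sub>R r) \<bullet> h)) (at x)"
proof -
  have d: "(u has_derivative (\<lambda>h. grad u (r *\<^sub>R x) \<bullet> h)) (at (r *\<^sub>R x))"
    by (rule has_derivative_grad[OF u_diff[OF assms(2)]])
  have 1: "((\<lambda>x. u (r *\<^sub>R x)) has_derivative (\<lambda>h. grad u (r *\<^sub>R x) \<bullet> (r *\<^sub>R h))) (at x)"
    by (rule has_derivative_compose[of "\<lambda>x. r *\<^sub>R x" "\<lambda>h. r *\<^sub>R h" x UNIV u, OF _ d]) (auto intro!: derivative_eq_intros)
  from has_derivative_mult_left[OF has_derivative_diff[OF 1 has_derivative_const], of "u 0" "inverse (r\<^sup>2)"]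
  have "(rescale u 0 r has_derivative (\<lambda>h. (grad u (r *\<^sub>R x) \<bullet> (r *\<^sub>R h) - 0) * inverse (r\<^sup>2))) (at x)"
    by (simp add: rescale_def[abs_def] divide_inverse)
  then show ?thesis
    by (rule has_derivative_eq_rhs) (use assms(1) in \<open>simp add: fun_eq_iff power2_eq_square field_simps\<close>)
qed

lemma rescale_minus_quadratic:
  assumes A: "transpose A = A" and "r > 0" "r *\<^sub>R x \<in> ball 0 1"
  shows "rescale u 0 r x - (1/2) * (x \<bullet> (A *v x)) = W A (r *\<^sub>R x) / r\<^sup>2"
    and "grad (rescale u 0 r) x - grad (\<lambda>x. (1/2) * (x \<bullet> (A *v x))) x = GW A (r *\<^sub>R x) /\<^sub>R r"
proof -
  have "A *v (r *\<^sub>R x) = r *\<^sub>R (A *v x)" by (simp add: matrix_vector_mult_scaleR)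
  then show "rescale u 0 r x - (1/2) * (x \<bullet> (A *v x)) = W A (r *\<^sub>R x) / r\<^sup>2"
    "grad (rescale u 0 r) x - grad (\<lambda>x. (1/2) * (x \<bullet> (A *v x))) x = GW A (r *\<^sub>R x) /\<^sub>R r"
    unfolding grad_eqI[OF rescale_has_derivative[OF assms(2,3)]] grad_eqI[OF has_derivative_quadratic[OF A]]
    using assms(2) by (simp_all add: rescale_def W_def GW_def field_simps power2_eq_square scaleR_diff_right)
qed

text \<open>The Monneau functional is only monotone for non-negative quadratics, so \<open>B\<close> is compensated by
  \<open>C\<close> times the multiple \<open>I\<close> of the identity; the limits of both monotone functions determine that of
  \<open>monneauW B\<close>.\<close>

lemma monneauW_tendsto_zero:
  assumes B: "transpose B = B" "trace B = 1" and r: "\<And>j. r j > 0" "r \<longlonglongrightarrow> 0"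
    and conv: "conv_C1alpha_loc sequentially \<alpha> (\<lambda>j. rescale u 0 (r j)) (\<lambda>x. (1/2) * (x \<bullet> (B *v x)))"
  shows "(monneauW B \<longlongrightarrow> 0) (at_right 0)"
proof -
  have r1: "\<forall>\<^sub>F j in sequentially. r j < s" if "s > 0" for s
    using order_tendstoD(2)[OF r(2) that] .
  have close: "\<forall>\<^sub>F j in sequentially. \<forall>x. norm x \<le> r j \<longrightarrow> \<bar>W B x\<bar> \<le> e * (r j)\<^sup>2 \<and> norm (GW B x) \<le> e * r j" if e: "e > 0" for e
  proof -
    have "\<forall>\<^sub>F j in sequentially. \<forall>x\<in>cball 0 1. \<bar>rescale u 0 (r j) x - (1/2) * (x \<bullet> (B *v x))\<bar> \<le> e
        \<and> norm (grad (rescale u 0 (r j)) x - grad (\<lambda>x. (1/2) * (x \<bullet> (B *v x))) x) \<le> e"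
      using conv[unfolded conv_C1alpha_loc_def, rule_format, OF zero_less_one e] by (rule eventually_mono) blast
    then show ?thesis using r1[OF zero_less_one]
    proof eventually_elim
      case (elim j)
      show ?case
      proof (intro allI impI)
        fix x :: "real^'n" assume x: "norm x \<le> r j"
        define y where "y = x /\<^sub>R r j"
        have y: "y \<in> cball 0 1" and xy: "r j *\<^sub>R y = x" using x r(1)[of j] by (auto simp: y_def field_simps)
        have "r j *\<^sub>R y \<in> ball 0 1" using x elim(2) by (simp add: xy)
        note eqs = rescale_minus_quadratic[OF B(1) r(1) this, unfolded xy]
        have "\<bar>W B x / (r j)\<^sup>2\<bar> \<le> e" "norm (GW B x /\<^sub>R r j) \<le> e"
          using elim(1) y unfolding eqs[symmetric] by auto
        then show "\<bar>W B x\<bar> \<le> e * (r j)\<^sup>2 \<and> norm (GW B x) \<le> e * r j"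
          using r(1)[of j] by (simp add: field_simps)
      qed
    qed
  qed
  let ?V = "unit_ball_vol (real CARD('n))"
  have weiss_nonneg: "0 \<le> weissW A s" if A: "transpose A = A" "trace A = 1" and s: "0 < s" "s < 1" for A s
  proof (rule ccontr)
    assume neg: "\<not> 0 \<le> weissW A s"
    define K where "K = onorm ((*v) (B - A))"
    define c where "c = (1 + 2 * K + 12 * (1 + K)) * ?V"
    have "K \<ge> 0" unfolding K_def by (rule onorm_matrix_nonneg)
    then have "c > 0" by (simp add: c_def add_pos_nonneg)
    \<comment> \<open>Small enough that \<open>weissW_bound\<close> keeps the functional at
      \<open>r j\<close> above half the supposed negative value at \<open>s\<close>, contradicting
      monotonicity.\<close>
    define e where "e = min 1 (- weissW A s / (2 * c))"
    have e: "0 < e" "e \<le> 1" "e * c \<le> - weissW A s / 2"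
      using neg \<open>c > 0\<close> by (auto simp: e_def min_def field_simps)
    obtain j where j: "\<forall>x. norm x \<le> r j \<longrightarrow> \<bar>W B x\<bar> \<le> e * (r j)\<^sup>2 \<and> norm (GW B x) \<le> e * r j" "r j < s"
      using eventually_happens'[OF _ eventually_conj[OF close[OF e(1)] r1[OF s(1)]]] by auto
    have "\<bar>weissW A (r j)\<bar> \<le> e * c"
      unfolding c_def by (rule weissW_bound[OF A B K_def r(1) _ e(1,2)]) (use j s in auto)
    moreover have "weissW A (r j) \<le> weissW A s"
      using weissW_mono[OF A r(1)[of j], of s] j s by auto
    ultimately show False using e neg by linarith
  qed
  define I where "I = (1 / real CARD('n)) *\<^sub>R (mat 1 :: real^'n^'n)"
  have I: "transpose I = I" "trace I = 1"
    by (auto simp: I_def trace_def mat_def transpose_def vec_eq_iff)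
  have I_quad: "(1/2) * (x \<bullet> (I *v x)) = (norm x)\<^sup>2 / (2 * real CARD('n))" for x
  proof -
    have "I *v x = (1 / real CARD('n)) *\<^sub>R x"
      by (simp add: I_def flip: scaleR_matrix_vector_assoc)
    then show ?thesis by (simp add: power2_norm_eq_inner field_simps)
  qed
  \<comment> \<open>The form of \<open>B\<close> is at least
    \<open>- onorm / 2 * (norm x)\<^sup>2\<close>, with the operator norm of \<open>B\<close>, and
    that of \<open>I\<close> is \<open>(norm x)\<^sup>2 / (2 * n)\<close>; this \<open>C\<close>
    makes the combination non-negative.\<close>
  define C where "C = onorm ((*v) B) * real CARD('n)"
  have "C \<ge> 0" by (simp add: C_def onorm_matrix_nonneg)
  interpret gB: gradient_lipschitz "W B" "GW B" "HW B" N "M + onorm ((*v) B)"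
    by (rule gradient_lipschitz_W[OF B(1)])
  interpret gI: gradient_lipschitz "W I" "GW I" "HW I" N "M + onorm ((*v) I)"
    by (rule gradient_lipschitz_W[OF I(1)])
  \<comment> \<open>On the flat set both \<open>lapW\<close> are -1, so the integrand is minus
    \<open>c * W B x + d * W I x\<close>, and only the combined quadratic needs a sign. Used with
    coefficients \<open>1, C\<close> and \<open>0, 1\<close>.\<close>
  have mono: "c * monneauW B a + d * monneauW I a \<le> c * monneauW B b + d * monneauW I b"
    if ab: "0 < a" "a \<le> b" "b < 1" and cd: "c \<ge> 0" "d \<ge> 0"
      and pos: "\<And>x. 0 \<le> c * ((1/2) * (x \<bullet> (B *v x))) + d * ((1/2) * (x \<bullet> (I *v x)))" for a b c d
  proof (rule DERIV_nonneg_imp_nondecreasing[OF ab(2)])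
    fix t assume "a \<le> t" "t \<le> b"
    then have t: "0 < t" "t < 1" using ab by auto
    let ?iB = "integral UNIV (\<lambda>x. bump t x ^ 3 * (W B x * lapW B x))"
    let ?iI = "integral UNIV (\<lambda>x. bump t x ^ 3 * (W I x * lapW I x))"
    have "((\<lambda>x. c * (bump t x ^ 3 * (W B x * lapW B x)) + d * (bump t x ^ 3 * (W I x * lapW I x))) has_integral c * ?iB + d * ?iI) UNIV"
      using gB.has_integral_w_lap[OF t] gI.has_integral_w_lap[OF t]
      by (intro has_integral_add has_integral_mult_right integrable_integral has_integral_integrable)
    then have "((\<lambda>x. bump t x ^ 3 * (c * (W B x * lapW B x) + d * (W I x * lapW I x))) has_integral c * ?iB + d * ?iI) UNIV"
      by (simp add: algebra_simps)
    then have int: "0 \<le> c * ?iB + d * ?iI"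
    proof (rule bump_int_nonneg_ae[OF _ t _ null])
      fix x :: "real^'n" assume x: "x \<in> ball 0 1" "x \<notin> N"
      show "0 \<le> c * (W B x * lapW B x) + d * (W I x * lapW I x)"
      proof (cases "grad u x = 0")
        case True
        have "c * W B x + d * W I x = (c + d) * (u x - u 0) - (c * ((1/2) * (x \<bullet> (B *v x))) + d * ((1/2) * (x \<bullet> (I *v x))))"
          by (simp add: W_def algebra_simps)
        moreover have "(c + d) * (u x - u 0) \<le> 0"
          using flat_le[OF x(1) True] cd by (intro mult_nonneg_nonpos) auto
        ultimately have "c * W B x + d * W I x \<le> 0" using pos[of x] by linarith
        then show ?thesis using lapW[OF B x] lapW[OF I x] True by simp
      next
        case False
        then show ?thesis using lapW[OF B x] lapW[OF I x] by simp
      qed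
    qed simp
    let ?y = "c * (weissW B t / (3 * t) + ?iB / (3 * t ^ (DIM(real^'n) + 9))) + d * (weissW I t / (3 * t) + ?iI / (3 * t ^ (DIM(real^'n) + 9)))"
    have der: "((\<lambda>t. c * monneauW B t + d * monneauW I t) has_real_derivative ?y) (at t)"
      by (intro DERIV_add DERIV_cmult gB.monneau_has_derivative gI.monneau_has_derivative t)
    have "?y = (c * weissW B t + d * weissW I t) / (3 * t) + (c * ?iB + d * ?iI) / (3 * t ^ (DIM(real^'n) + 9))"
      by (simp add: add_divide_distrib distrib_left)
    also have "\<dots> \<ge> 0"
      using int cd weiss_nonneg[OF B t] weiss_nonneg[OF I t] t
      by (intro add_nonneg_nonneg[OF divide_nonneg_pos divide_nonneg_pos]) auto
    finally show "\<exists>y. ((\<lambda>t. c * monneauW B t + d * monneauW I t) has_real_derivative y) (at t) \<and> 0 \<le> y"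
      using der by blast
  qed
  have "\<exists>l. ((\<lambda>t. 1 * monneauW B t + C * monneauW I t) \<longlongrightarrow> l) (at_right 0)"
  proof (rule mono_bounded_tendsto_at_right[where c = 0])
    show "1 * monneauW B a + C * monneauW I a \<le> 1 * monneauW B b + C * monneauW I b" if "0 < a" "a \<le> b" "b < 1" for a b
    proof (rule mono[OF that])
      fix x :: "real^'n"
      show "0 \<le> 1 * ((1/2) * (x \<bullet> (B *v x))) + C * ((1/2) * (x \<bullet> (I *v x)))"
        using abs_quadratic_le[of x B] unfolding I_quad by (simp add: C_def)
    qed (use \<open>C \<ge> 0\<close> in auto)
    show "0 \<le> 1 * monneauW B a + C * monneauW I a" if "0 < a" "a < 1" for a
      using gB.monneau_nonneg[OF that] gI.monneau_nonneg[OF that] \<open>C \<ge> 0\<close> by simp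
  qed
  then obtain l1 where l1: "((\<lambda>t. 1 * monneauW B t + C * monneauW I t) \<longlongrightarrow> l1) (at_right 0)" ..
  have "\<exists>l. (monneauW I \<longlongrightarrow> l) (at_right 0)"
  proof (rule mono_bounded_tendsto_at_right[where c = 0])
    show "monneauW I a \<le> monneauW I b" if "0 < a" "a \<le> b" "b < 1" for a b
    proof -
      have "0 \<le> (1/2) * (x \<bullet> (I *v x))" for x unfolding I_quad by simp
      then show ?thesis using mono[OF that, of 0 1] by simp
    qed
  qed (use gI.monneau_nonneg in auto)
  then obtain l2 where l2: "(monneauW I \<longlongrightarrow> l2) (at_right 0)" ..
  have lim: "(monneauW B \<longlongrightarrow> l1 - C * l2) (at_right 0)"
    using tendsto_diff[OF l1 tendsto_mult_left[OF l2, of C]] by simp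
  have "filterlim r (at_right 0) sequentially"
    using r by (intro filterlim_at_withinI always_eventually) (auto intro: less_imp_neq[symmetric])
  then have seq: "(\<lambda>j. monneauW B (r j)) \<longlonglongrightarrow> l1 - C * l2"
    by (rule filterlim_compose[OF lim])
  have "(\<lambda>j. monneauW B (r j)) \<longlonglongrightarrow> 0"
  proof (rule tendstoI)
    fix e :: real assume "e > 0"
    define \<delta> where "\<delta> = sqrt (e / (2 * ?V))"
    have V: "?V > 0" by simp
    then have "\<delta> > 0" and \<delta>: "\<delta>\<^sup>2 * ?V < e" using \<open>e > 0\<close> by (simp_all add: \<delta>_def)
    show "\<forall>\<^sub>F j in sequentially. dist (monneauW B (r j)) 0 < e"
      using close[OF \<open>\<delta> > 0\<close>] r1[OF zero_less_one]
    proof eventually_elim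
      case (elim j)
      have "monneauW B (r j) \<le> \<delta>\<^sup>2 * unit_ball_vol (real DIM(real^'n))"
        by (rule gB.monneau_le) (use elim r in auto)
      then show ?case using gB.monneau_nonneg[of "r j"] elim r \<delta> by simp
    qed
  qed
  then have "l1 - C * l2 = 0" using seq LIMSEQ_unique by blast
  then show ?thesis using lim by simp
qed

text \<open>The rescaled gradient error keeps the Lipschitz constant \<open>L\<close> at every
  radius while its supremum tends to zero; interpolating between the two gives the Hoelder
  seminorm.\<close>

lemma expansion_imp_conv:
  assumes A: "transpose A = A" and \<alpha>: "\<alpha> \<in> {0<..<1}"
    and w: "\<And>e. e > 0 \<Longrightarrow> \<exists>s>0. \<forall>x. norm x < s \<longrightarrow> \<bar>W A x\<bar> \<le> e * (norm x)\<^sup>2"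
    and g: "\<And>e. e > 0 \<Longrightarrow> \<exists>s>0. \<forall>x. norm x < s \<longrightarrow> norm (GW A x) \<le> e * norm x"
  shows "conv_C1alpha_loc (at_right 0) \<alpha> (\<lambda>r. rescale u 0 r) (\<lambda>x. (1/2) * (x \<bullet> (A *v x)))"
  unfolding conv_C1alpha_loc_def
proof (intro allI impI)
  fix R e :: real assume R: "R > 0" and e: "e > 0"
  define L where "L = M + onorm ((*v) A)"
  have L: "L > 0" using M onorm_matrix_nonneg[of A] by (simp add: L_def)
  interpret gradient_lipschitz "W A" "GW A" "HW A" N L
    unfolding L_def by (rule gradient_lipschitz_W[OF A])
  obtain \<tau> where \<tau>: "\<tau> > 0" "\<And>D t. 0 \<le> D \<Longrightarrow> 0 < t \<Longrightarrow> D \<le> \<tau> \<Longrightarrow> D \<le> L * t \<Longrightarrow> D \<le> e * t powr \<alpha>"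
    using holder_interpolation[of \<alpha> L e] \<alpha> L e by auto
  obtain s1 where s1: "s1 > 0" "\<And>x. norm x < s1 \<Longrightarrow> \<bar>W A x\<bar> \<le> (e / R\<^sup>2) * (norm x)\<^sup>2"
    using w[of "e / R\<^sup>2"] e R by auto
  \<comment> \<open>One factor for two purposes: the rescaled gradient error is at most
    \<open>d * R\<close>, which must stay below \<open>e\<close>, and twice that below
    \<open>\<tau>\<close> to bound a difference at two points.\<close>
  define d where "d = min (e / R) (\<tau> / (2 * R))"
  have d: "d > 0" "d * R \<le> e" "2 * (d * R) \<le> \<tau>" using e R \<tau>(1) by (auto simp: d_def min_def field_simps)
  obtain s2 where s2: "s2 > 0" "\<And>x. norm x < s2 \<Longrightarrow> norm (GW A x) \<le> d * norm x"
    using g[OF d(1)] by auto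
  define s where "s = min 1 (min s1 s2) / R"
  have "s > 0" using s1 s2 R by (simp add: s_def)
  let ?q = "\<lambda>x. (1/2) * (x \<bullet> (A *v x))"
  have main: "(\<forall>x\<in>cball 0 R. rescale u 0 r differentiable at x) \<and>
      (\<forall>x\<in>cball 0 R. \<bar>rescale u 0 r x - ?q x\<bar> \<le> e \<and> norm (grad (rescale u 0 r) x - grad ?q x) \<le> e) \<and>
      (\<forall>x\<in>cball 0 R. \<forall>y\<in>cball 0 R. x \<noteq> y \<longrightarrow>
        norm (grad (rescale u 0 r) x - grad ?q x - (grad (rescale u 0 r) y - grad ?q y)) \<le> e * norm (x - y) powr \<alpha>)"
    if r: "r \<in> {0<..<s}" for r
  proof -
    have r0: "r > 0" using r by simp
    have nrm: "norm (r *\<^sub>R x) < min 1 (min s1 s2)" "norm (r *\<^sub>R x) \<le> r * R" if "x \<in> cball 0 R" for x :: "real^'n"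
    proof -
      show "norm (r *\<^sub>R x) \<le> r * R" using that r0 by simp
      also have "r * R < s * R" using r R by simp
      also have "\<dots> = min 1 (min s1 s2)" using R by (simp add: s_def)
      finally show "norm (r *\<^sub>R x) < min 1 (min s1 s2)" .
    qed
    have inb: "r *\<^sub>R x \<in> ball 0 1" if "x \<in> cball 0 R" for x :: "real^'n" using nrm[OF that] by simp
    note eqs = rescale_minus_quadratic[OF A r0 inb]
    have val: "\<bar>W A (r *\<^sub>R x) / r\<^sup>2\<bar> \<le> e" if x: "x \<in> cball 0 R" for x
    proof -
      have "\<bar>W A (r *\<^sub>R x)\<bar> \<le> (e / R\<^sup>2) * (norm (r *\<^sub>R x))\<^sup>2" using nrm(1)[OF x] by (intro s1(2)) simp
      also have "\<dots> \<le> (e / R\<^sup>2) * (r * R)\<^sup>2" using nrm(2)[OF x] e by (intro mult_left_mono power_mono) auto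
      also have "\<dots> = e * r\<^sup>2" using R by (simp add: power_mult_distrib)
      finally show ?thesis using r0 by (simp add: field_simps)
    qed
    have grd: "norm (GW A (r *\<^sub>R x) /\<^sub>R r) \<le> d * R" if x: "x \<in> cball 0 R" for x
    proof -
      have "norm (GW A (r *\<^sub>R x)) \<le> d * norm (r *\<^sub>R x)" using nrm(1)[OF x] by (intro s2(2)) simp
      also have "\<dots> \<le> d * (r * R)" using nrm(2)[OF x] d by (intro mult_left_mono) auto
      finally show ?thesis using r0 by (simp add: field_simps)
    qed
    have hld: "norm (GW A (r *\<^sub>R x) /\<^sub>R r - GW A (r *\<^sub>R y) /\<^sub>R r) \<le> e * norm (x - y) powr \<alpha>"
      if x: "x \<in> cball 0 R" and y: "y \<in> cball 0 R" and "x \<noteq> y" for x y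
    proof (rule \<tau>(2))
      show "norm (GW A (r *\<^sub>R x) /\<^sub>R r - GW A (r *\<^sub>R y) /\<^sub>R r) \<le> \<tau>"
        using norm_triangle_ineq4[of "GW A (r *\<^sub>R x) /\<^sub>R r" "GW A (r *\<^sub>R y) /\<^sub>R r"] grd[OF x] grd[OF y] d(3) by linarith
      have "norm (GW A (r *\<^sub>R x) /\<^sub>R r - GW A (r *\<^sub>R y) /\<^sub>R r) = norm (GW A (r *\<^sub>R x) - GW A (r *\<^sub>R y)) / r"
        unfolding scaleR_diff_right[symmetric] using r0 by (simp add: divide_inverse mult.commute)
      also have "\<dots> \<le> L * norm (r *\<^sub>R x - r *\<^sub>R y) / r"
        using G_lip[OF inb[OF x] inb[OF y]] r0 by (intro divide_right_mono) auto
      also have "\<dots> = L * norm (x - y)" unfolding scaleR_diff_right[symmetric] using r0 by simp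
      finally show "norm (GW A (r *\<^sub>R x) /\<^sub>R r - GW A (r *\<^sub>R y) /\<^sub>R r) \<le> L * norm (x - y)" .
    qed (use that in auto)
    show ?thesis
    proof (intro conjI ballI impI)
      fix x :: "real^'n" assume x: "x \<in> cball 0 R"
      show "rescale u 0 r differentiable at x"
        using rescale_has_derivative[OF r0 inb[OF x]] by (rule differentiableI)
      show "\<bar>rescale u 0 r x - ?q x\<bar> \<le> e" unfolding eqs(1)[OF x] by (rule val[OF x])
      show "norm (grad (rescale u 0 r) x - grad ?q x) \<le> e"
        unfolding eqs(2)[OF x] using grd[OF x] d(2) by linarith
      fix y :: "real^'n" assume y: "y \<in> cball 0 R" and "x \<noteq> y"
      show "norm (grad (rescale u 0 r) x - grad ?q x - (grad (rescale u 0 r) y - grad ?q y)) \<le> e * norm (x - y) powr \<alpha>"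
        unfolding eqs(2)[OF x] eqs(2)[OF y] by (rule hld[OF x y \<open>x \<noteq> y\<close>])
    qed
  qed
  show "\<forall>\<^sub>F r in at_right 0. (\<forall>x\<in>cball 0 R. rescale u 0 r differentiable at x) \<and>
      (\<forall>x\<in>cball 0 R. \<bar>rescale u 0 r x - ?q x\<bar> \<le> e \<and> norm (grad (rescale u 0 r) x - grad ?q x) \<le> e) \<and>
      (\<forall>x\<in>cball 0 R. \<forall>y\<in>cball 0 R. x \<noteq> y \<longrightarrow>
        norm (grad (rescale u 0 r) x - grad ?q x - (grad (rescale u 0 r) y - grad ?q y)) \<le> e * norm (x - y) powr \<alpha>)"
    by (rule eventually_at_rightI[OF main \<open>s > 0\<close>])
qed

end

theorem theorem1p1:
  fixes u :: "real^'n \<Rightarrow> real" and M :: real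
  assumes "supercond_solution u M"
    and "0 \<in> singular_set u"
    and "\<forall>x\<in>ball 0 1. grad u x = 0 \<longrightarrow> u x \<le> u 0"
  shows "\<exists>q0\<in>quad_Q.
           (\<forall>\<alpha>\<in>{0<..<1}. conv_C1alpha_loc (at_right 0) \<alpha> (\<lambda>r. rescale u 0 r) q0) \<and>
           ((\<lambda>x. (u x - u 0 - q0 x) / (norm x)\<^sup>2) \<longlongrightarrow> 0) (at 0)"
proof -
  have sol: "M > 0" "\<And>x. x \<in> ball 0 1 \<Longrightarrow> u differentiable (at x)"
    "\<And>x y. x \<in> ball 0 1 \<Longrightarrow> y \<in> ball 0 1 \<Longrightarrow> norm (grad u x - grad u y) \<le> M * norm (x - y)"
    "AE x in lebesgue. x \<in> ball 0 1 \<longrightarrow> grad u differentiable (at x) \<and> laplacian u x = (if grad u x \<noteq> 0 then 1 else 0)"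
    "0 \<in> free_boundary u"
    using assms(1) unfolding supercond_solution_def by blast+
  obtain N where N: "{x \<in> space lebesgue. \<not> (x \<in> ball 0 1 \<longrightarrow> grad u differentiable (at x) \<and> laplacian u x = (if grad u x \<noteq> 0 then 1 else 0))} \<subseteq> N"
      "emeasure lebesgue N = 0" "N \<in> sets lebesgue"
    using sol(4) by (rule AE_E)
  interpret superconductor u M N
  proof
    show "negligible N" using N by (auto simp: negligible_iff_null_sets)
  qed (use sol N assms(3) in auto)
  \<comment> \<open>The set with non-zero gradient is open by continuity of \<open>grad u\<close>,
    hence disjoint from its frontier, which contains the origin.\<close>
  have grad0: "grad u 0 = 0"
  proof (rule ccontr)
    assume "grad u 0 \<noteq> 0"
    have cont: "continuous_on (ball 0 1) (grad u)"
    proof (rule lipschitz_on_continuous_on[OF lipschitz_onI])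
      show "dist (grad u x) (grad u y) \<le> M * dist x y" if "x \<in> ball 0 1" "y \<in> ball 0 1" for x y
        using grad_lip[OF that] by (simp add: dist_norm)
    qed (use M in auto)
    have "open {x \<in> ball 0 1. grad u x \<noteq> 0}"
      using continuous_open_preimage[OF cont open_ball, of "- {0}"] by (simp add: vimage_def Int_def open_Compl)
    then have "0 \<notin> frontier {x \<in> ball 0 1. grad u x \<noteq> 0}"
      using \<open>grad u 0 \<noteq> 0\<close> by (simp add: frontier_def interior_open)
    then show False using sol(5) by (simp add: free_boundary_def)
  qed
  obtain r q where r: "\<And>j. r j > 0" "r \<longlonglongrightarrow> 0" and q: "q \<in> quad_Q"
    and conv: "\<forall>\<alpha>\<in>{0<..<1}. conv_C1alpha_loc sequentially \<alpha> (\<lambda>j. rescale u 0 (r j)) q"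
    using assms(2) unfolding singular_set_def by blast
  obtain A where A: "transpose A = A" "trace A = 1" and q_def: "q = (\<lambda>x. (1/2) * (x \<bullet> (A *v x)))"
    using q unfolding quad_Q_def by blast
  interpret gradient_lipschitz "W A" "GW A" "HW A" N "M + onorm ((*v) A)"
    by (rule gradient_lipschitz_W[OF A(1)])
  have lim: "(monneauW A \<longlongrightarrow> 0) (at_right 0)"
    by (rule monneauW_tendsto_zero[OF A r, of "1/2"]) (use conv q_def in auto)
  have W0: "W A 0 = 0" and G0: "GW A 0 = 0" using grad0 by (simp_all add: W_def GW_def)
  have L: "M + onorm ((*v) A) > 0" using M onorm_matrix_nonneg[of A] by simp
  note w = w_small[OF W0 G0 L lim]
  note g = G_small[OF G0 L _ w]
  have "conv_C1alpha_loc (at_right 0) \<alpha> (\<lambda>r. rescale u 0 r) q" if "\<alpha> \<in> {0<..<1}" for \<alpha>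
    unfolding q_def by (rule expansion_imp_conv[OF A(1) that w g])
  moreover have "((\<lambda>x. (u x - u 0 - q x) / (norm x)\<^sup>2) \<longlongrightarrow> 0) (at 0)"
  proof (rule tendstoI)
    fix e :: real assume "e > 0"
    then obtain s where s: "s > 0" "\<And>x. norm x < s \<Longrightarrow> \<bar>W A x\<bar> \<le> e / 2 * (norm x)\<^sup>2"
      using w[of "e / 2"] by auto
    have "dist ((u x - u 0 - q x) / (norm x)\<^sup>2) 0 < e" if "x \<noteq> 0" "norm x < s" for x
    proof -
      have "\<bar>W A x\<bar> / (norm x)\<^sup>2 \<le> e / 2" using s(2)[OF that(2)] that(1) by (simp add: field_simps)
      moreover have "dist ((u x - u 0 - q x) / (norm x)\<^sup>2) 0 = \<bar>W A x\<bar> / (norm x)\<^sup>2" by (simp add: W_def q_def)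
      ultimately show ?thesis using \<open>e > 0\<close> by linarith
    qed
    then show "\<forall>\<^sub>F x in at 0. dist ((u x - u 0 - q x) / (norm x)\<^sup>2) 0 < e"
      unfolding eventually_at using s(1) by (intro exI[of _ s]) auto
  qed
  ultimately show ?thesis using q by blast
qed

end
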